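(* Let $g\geqslant 2$ be a fixed integer. Then there exist quasi-modular forms $f_1,\dots,f_{g-3}$ (no forms if $g\leqslant 3$, in which case the sum below is empty), vanishing at $0$ (i.e. having zero constant term), such that $$AR_g^\star(n,x)=\binom{n}{g-1}+\sum_{k=1}^{g-3} f_k(x)\,n^k\ \in\ \mathbb{Q}[\![x]\!][n],$$ where $AR_g^\star(n,x)$ is the asymptotic refined invariant of abelian surfaces for genus $g$ curves in a fixed linear system.
   Context: **Polarizations.** $\mathscr{B}$ denotes the set of $2\times 2$ integer matrices $B$ with $\det(B)>0$. For $k\geqslant 1$, $k|B$ means that $k$ divides all entries of $B$. **Refined invariants.** For $g\geqslant 2$ and $B\in\mathscr{B}$, the refined invariant $BG_{g,B}(q)\in\mathbb{Z}[q^{\pm1}]$ is the count of genus $g$ tropical curves of degree $B$ through $g$ generic points of a generic tropical abelian surface with polarization $B$. Each trivalent curve $\Gamma$, with gcd of edge slopes $\delta$, is counted with multiplicity $\sum_{k|\delta}\varphi(k)k^{2g-2}\prod_V(q^{m_V/2k}-q^{-m_V/2k})$, where $\varphi$ is the Euler function and $m_V$ is the absolute value of the determinant of two of the three outgoing slopes at the vertex $V$. It is known, and may be taken as the definition of $BG_{g,B}$ here, that $$BG_{g,B}(q)=\sum_{k|B}k^{2g-1}BG_{g,\det(B)/k^2}(q^k),$$ where for an integer $n\geqslant 1$ (the case of a primitive $B$ of determinant $n$) $$BG_{g,n}(q)=g\sum_{a_1+\cdots+a_{g-1}=n}P_{a_1}(q)\cdots P_{a_{g-1}}(q),\qquad P_a(q)=\sum_{k|a}\frac{a}{k}(q^k-2+q^{-k}),$$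 the sum being over tuples of integers $a_j\geqslant 1$. The invariant for curves in a fixed linear system (passing through $g-2$ points) is $$BG^\star_{g,B}(q)=\frac{\det(B)}{g(g-1)}BG_{g,B}(q).$$ **Shift to polynomials.** Set $\overline{BG}^\star_{g,B}(x)=x^{\det(B)}BG^\star_{g,B}(1/x)\in\mathbb{Q}[x]$. **Asymptotic refined invariant.** $AR_g^\star(n,x)\in\mathbb{Q}[\![x]\!][n]$ is the (unique, existing) polynomial in $n$ with coefficients in $\mathbb{Q}[\![x]\!]$ such that for every $i\geqslant 0$ there is $N$ such that for every $B\in\mathscr{B}$ with $\det(B)\geqslant N$ one has $$\overline{BG}^\star_{g,B}(x)\equiv AR^\star_g(\det(B),x)\mod x^{i+1}.$$ **Conventions.** $\binom{n}{m}=\frac{n(n-1)\cdots(n-m+1)}{m!}$ is viewed as a polynomial in $n$. A quasi-modular form is identified with its Fourier expansion in the variable $x$, a formal power series, and is not required to be of homogeneous weight: quasi-modular forms are the elements of the ring generated by the constants and by the (level one) Eisenstein series of weights $2,4,6$. In particular the series $\sum_{a\geqslant1}\sigma_{2j-1}(a)x^a$, $j\geqslant 1$, where $\sigma_k(a)=\sum_{d|a}d^k$, are quasi-modular forms in this sense. *)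

theory Defs
  imports
    "HOL-Analysis.Determinants"
    "HOL-Library.Poly_Mapping"
    "HOL-Computational_Algebra.Polynomial_FPS"
begin

text \<open>The Laurent polynomial ring over \<open>R\<close> in one variable \<open>q\<close> is the monoid ring
  \<open>int \<Rightarrow>\<^sub>0 R\<close> with its convolution product; the monomial \<open>q^k\<close> is \<open>Poly_Mapping.single k 1\<close>.\<close>

definition laurent_subst :: "int \<Rightarrow> (int \<Rightarrow>\<^sub>0 int) \<Rightarrow> (int \<Rightarrow>\<^sub>0 int)"
  \<comment> \<open>the substitution \<open>f(q) \<mapsto> f(q^k)\<close>\<close>
  where "laurent_subst k f =
    (\<Sum>e\<in>Poly_Mapping.keys f. Poly_Mapping.single (k * e) (Poly_Mapping.lookup f e))"

definition polarizations :: "(int ^ 2 ^ 2) set"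
  where "polarizations = {B. det B > 0}"

definition nat_dvd_mat :: "nat \<Rightarrow> int ^ 2 ^ 2 \<Rightarrow> bool"
  where "nat_dvd_mat k B \<longleftrightarrow> (\<forall>i j. int k dvd B $ i $ j)"

text \<open>The refined count \<open>BG g B\<close> of genus \<open>g\<close> tropical curves of degree \<open>B\<close> through \<open>g\<close> points of
  a tropical abelian surface is defined by its known multiple cover formula over the primitive
  counts \<open>BG_prim\<close>; \<open>BG_star\<close> is the count of curves in a fixed linear system.\<close>

definition P :: "nat \<Rightarrow> (int \<Rightarrow>\<^sub>0 int)"
  where "P a = (\<Sum>k | k dvd a. of_nat (a div k) *
    (Poly_Mapping.single (int k) 1 - 2 + Poly_Mapping.single (- int k) 1))"

definition BG_prim :: "nat \<Rightarrow> nat \<Rightarrow> (int \<Rightarrow>\<^sub>0 int)"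
  where "BG_prim g n = of_nat g *
    (\<Sum>as | length as = g - 1 \<and> (\<forall>a\<in>set as. a \<ge> 1) \<and> sum_list as = n. prod_list (map P as))"

definition BG :: "nat \<Rightarrow> int ^ 2 ^ 2 \<Rightarrow> (int \<Rightarrow>\<^sub>0 int)"
  where "BG g B = (\<Sum>k | k \<ge> 1 \<and> nat_dvd_mat k B.
    of_nat (k ^ (2 * g - 1)) * laurent_subst (int k) (BG_prim g (nat (det B) div k\<^sup>2)))"

definition BG_star :: "nat \<Rightarrow> int ^ 2 ^ 2 \<Rightarrow> (int \<Rightarrow>\<^sub>0 rat)"
  where "BG_star g B =
    Poly_Mapping.map (\<lambda>c. of_int (det B) / (of_nat g * (of_nat g - 1)) * of_int c) (BG g B)"

text \<open>\<open>BG_star_bar g B\<close> is \<open>x^det(B) BG_star(1/x)\<close>: the monomial \<open>q^e\<close> becomes \<open>x^(det(B) - e)\<close>.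
  The truncation by \<open>nat\<close> is harmless since all exponents of \<open>BG_star g B\<close> are at most \<open>det B\<close>;
  see lemma \<open>keys_BG_star_le\<close> below.\<close>

definition BG_star_bar :: "nat \<Rightarrow> int ^ 2 ^ 2 \<Rightarrow> rat poly"
  where "BG_star_bar g B = (\<Sum>e\<in>Poly_Mapping.keys (BG_star g B).
    monom (Poly_Mapping.lookup (BG_star g B) e) (nat (det B - e)))"

text \<open>A polynomial in \<open>n\<close> with coefficients in the power series ring in \<open>x\<close> over the rationals is an
  element of \<open>rat fps poly\<close>.\<close>

definition is_asymptotic_invariant :: "nat \<Rightarrow> rat fps poly \<Rightarrow> bool"
  where "is_asymptotic_invariant g A \<longleftrightarrow>
    (\<forall>i. \<exists>N. \<forall>B\<in>polarizations. det B \<ge> N \<longrightarrow>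
      fps_X ^ (i + 1) dvd (fps_of_poly (BG_star_bar g B) - poly A (of_int (det B))))"

text \<open>The defining property has exactly one solution for \<open>g \<ge> 2\<close>.\<close>

definition AR_star :: "nat \<Rightarrow> rat fps poly"
  where "AR_star g = (THE A. is_asymptotic_invariant g A)"

definition binomial_poly :: "nat \<Rightarrow> rat fps poly"
  where "binomial_poly m = smult (fps_const (1 / fact m)) (\<Prod>i<m. [:- of_nat i, 1:])"

definition divisor_sigma :: "nat \<Rightarrow> nat \<Rightarrow> nat"
  where "divisor_sigma k a = (\<Sum>d | d dvd a. d ^ k)"

definition E2 :: "rat fps"
  where "E2 = 1 - 24 * Abs_fps (\<lambda>a. if a = 0 then 0 else of_nat (divisor_sigma 1 a))"

definition E4 :: "rat fps"
  where "E4 = 1 + 240 * Abs_fps (\<lambda>a. if a = 0 then 0 else of_nat (divisor_sigma 3 a))"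

definition E6 :: "rat fps"
  where "E6 = 1 - 504 * Abs_fps (\<lambda>a. if a = 0 then 0 else of_nat (divisor_sigma 5 a))"

text \<open>Quasi-modular forms of level one and mixed weight with rational Fourier coefficients, as
  Fourier expansions: the ring generated by the constants and \<open>E2\<close>, \<open>E4\<close>, \<open>E6\<close>.\<close>

inductive_set quasi_modular :: "rat fps set"
  where
    const: "fps_const c \<in> quasi_modular"
  | E2: "E2 \<in> quasi_modular"
  | E4: "E4 \<in> quasi_modular"
  | E6: "E6 \<in> quasi_modular"
  | add: "f \<in> quasi_modular \<Longrightarrow> h \<in> quasi_modular \<Longrightarrow> f + h \<in> quasi_modular"
  | mult: "f \<in> quasi_modular \<Longrightarrow> h \<in> quasi_modular \<Longrightarrow> f * h \<in> quasi_modular"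

definition exps_le :: "int \<Rightarrow> (int \<Rightarrow>\<^sub>0 int) \<Rightarrow> bool"
  where "exps_le n f \<longleftrightarrow> (\<forall>e\<in>Poly_Mapping.keys f. e \<le> n)"

lemma exps_le_sum: "(\<And>i. i \<in> I \<Longrightarrow> exps_le n (f i)) \<Longrightarrow> exps_le n (sum f I)"
proof (induction I rule: infinite_finite_induct)
  case (insert i I)
  then show ?case
    using Poly_Mapping.keys_add[of "f i" "sum f I"] by (auto simp: exps_le_def)
qed (auto simp: exps_le_def)

lemma exps_le_mult: "exps_le m f \<Longrightarrow> exps_le n h \<Longrightarrow> exps_le (m + n) (f * h)"
  using Poly_Mapping.keys_mult[of f h] unfolding exps_le_def by (fastforce intro: add_mono)

lemma exps_le_of_nat: "exps_le 0 (of_nat n)"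
proof (induction n)
  case (Suc n)
  then show ?case
    using Poly_Mapping.keys_add[of "1 :: int \<Rightarrow>\<^sub>0 int" "of_nat n"]
    by (auto simp: exps_le_def)
qed (auto simp: exps_le_def)

lemma exps_le_P:
  assumes "a \<ge> 1"
  shows "exps_le (int a) (P a)"
  unfolding P_def
proof (rule exps_le_sum)
  fix k assume "k \<in> {k. k dvd a}"
  then have ka: "k \<le> a" using assms by (auto dest: dvd_imp_le)
  let ?u = "Poly_Mapping.single (int k) 1 :: int \<Rightarrow>\<^sub>0 int"
  let ?v = "Poly_Mapping.single (- int k) 1 :: int \<Rightarrow>\<^sub>0 int"
  have "Poly_Mapping.keys (2 :: int \<Rightarrow>\<^sub>0 int) \<subseteq> {0}"
    using Poly_Mapping.keys_add[of "1 :: int \<Rightarrow>\<^sub>0 int" 1] by auto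
  then have "Poly_Mapping.keys (?u - 2 + ?v) \<subseteq> {int k, 0, - int k}"
    using Poly_Mapping.keys_add[of "?u - 2" ?v] Poly_Mapping.keys_diff[of ?u 2] by fastforce
  then have "exps_le (int a) (?u - 2 + ?v)"
    using ka by (fastforce simp: exps_le_def)
  from exps_le_mult[OF exps_le_of_nat this]
  show "exps_le (int a) (of_nat (a div k) * (?u - 2 + ?v))" by simp
qed

lemma exps_le_prod_P:
  "(\<forall>a\<in>set as. a \<ge> 1) \<Longrightarrow> exps_le (int (sum_list as)) (prod_list (map P as))"
proof (induction as)
  case Nil
  then show ?case by (simp add: exps_le_def)
next
  case (Cons a as)
  then show ?case
    using exps_le_mult[OF exps_le_P[of a], of "int (sum_list as)" "prod_list (map P as)"] by simp
qed

lemma exps_le_BG_prim: "exps_le (int n) (BG_prim g n)"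
proof -
  have "exps_le (int n) (\<Sum>as | length as = g - 1 \<and> (\<forall>a\<in>set as. a \<ge> 1) \<and> sum_list as = n.
      prod_list (map P as))"
    by (rule exps_le_sum) (use exps_le_prod_P in auto)
  from exps_le_mult[OF exps_le_of_nat this] show ?thesis
    unfolding BG_prim_def by simp
qed

lemma exps_le_BG:
  assumes "B \<in> polarizations"
  shows "exps_le (det B) (BG g B)"
  unfolding BG_def
proof (rule exps_le_sum)
  fix k assume "k \<in> {k. k \<ge> 1 \<and> nat_dvd_mat k B}"
  then have k: "k \<ge> 1" by auto
  let ?n = "nat (det B) div k\<^sup>2"
  have n: "int k * int ?n \<le> det B"
  proof -
    have "k * ?n \<le> k\<^sup>2 * ?n" using k by (simp add: power2_eq_square)
    also have "\<dots> \<le> nat (det B)" by simp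
    finally have "int (k * ?n) \<le> int (nat (det B))" by (simp only: of_nat_le_iff)
    then show ?thesis using assms by (simp add: polarizations_def)
  qed
  have "exps_le (det B) (laurent_subst (int k) (BG_prim g ?n))"
    unfolding laurent_subst_def
  proof (rule exps_le_sum)
    fix e assume "e \<in> Poly_Mapping.keys (BG_prim g ?n)"
    then have "e \<le> int ?n" using exps_le_BG_prim by (auto simp: exps_le_def)
    then have "int k * e \<le> int k * int ?n" by (intro mult_left_mono) auto
    then have "int k * e \<le> det B" using n by linarith
    then show "exps_le (det B)
        (Poly_Mapping.single (int k * e) (Poly_Mapping.lookup (BG_prim g ?n) e))"
      by (auto simp: exps_le_def split: if_splits)
  qed
  from exps_le_mult[OF exps_le_of_nat this]
  show "exps_le (det B)
      (of_nat (k ^ (2 * g - 1)) * laurent_subst (int k) (BG_prim g ?n))" by (simp only: add_0)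
qed

lemma keys_BG_star_le:
  assumes "B \<in> polarizations" and "e \<in> Poly_Mapping.keys (BG_star g B)"
  shows "e \<le> det B"
proof -
  have "Poly_Mapping.keys (BG_star g B) \<subseteq> Poly_Mapping.keys (BG g B)"
    unfolding BG_star_def by (auto simp: in_keys_iff Poly_Mapping.map.rep_eq when_def)
  then show ?thesis using exps_le_BG[OF assms(1)] assms(2) by (auto simp: exps_le_def)
qed

end

theory Submission
  imports Defs
begin

text \<open>Near its top exponent \<open>n\<close> the primitive invariant is \<open>g\<close> times the coefficient of \<open>t^n\<close> in
  \<open>(t / (1 - t) + p)^(g - 1)\<close>, where \<open>p = \<Sum>a. (x^a P_a(1/x) - 1) t^a\<close>. Modulo each power of \<open>x\<close> the series
  \<open>p\<close> is a polynomial in \<open>t\<close>, so the binomial theorem gives a polynomial in \<open>n\<close>, whose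
  coefficients are polynomials in the moments \<open>(t d/dt)^l p\<close> at \<open>t = 1\<close>. Those are combinations of
  derivatives of the Eisenstein series \<open>\<Sum>a. \<sigma>_{2j-1}(a) x^a\<close>, and the zeroth one vanishes.

  That these derivatives are quasi-modular follows from Ramanujan-type identities, obtained by
  comparing sums over \<open>a x + b y = n\<close> under the substitution \<open>(a, b, x, y) \<mapsto> (a - b, b, x, x + y)\<close>.
  One of them is \<open>E\<^sub>8 = E\<^sub>4\<^sup>2\<close>; a second family, one for each weight, expresses the derivative of an
  Eisenstein series by the next one and products. Together they yield closure under
  differentiation and membership of all Eisenstein series.\<close>

section \<open>Divisor sums and the equation \<open>a x + b y = n\<close>\<close>

text \<open>For odd \<open>k\<close> this is, up to a rational factor, the nonconstant part of the
  Eisenstein series of weight \<open>k + 1\<close>.\<close>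

definition sigma_fps :: "nat \<Rightarrow> rat fps"
  where "sigma_fps k = Abs_fps (\<lambda>a. if a = 0 then 0 else of_nat (divisor_sigma k a))"

definition theta :: "rat fps \<Rightarrow> rat fps"
  where "theta f = fps_X * fps_deriv f"

definition quads :: "nat \<Rightarrow> (nat \<times> nat \<times> nat \<times> nat) set"
  where "quads n = {(a, b, x, y). a > 0 \<and> b > 0 \<and> x > 0 \<and> y > 0 \<and> a * x + b * y = n}"

lemma finite_quads [simp]: "finite (quads n)"
proof (rule finite_subset)
  have *: "a \<le> n \<and> b \<le> n \<and> x \<le> n \<and> y \<le> n"
    if "a > 0" "b > 0" "x > 0" "y > 0" "a * x + b * y = n" for a b x y
  proof -
    have "a * 1 \<le> a * x" "1 * x \<le> a * x" "b * 1 \<le> b * y" "1 * y \<le> b * y"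
      using that by (auto intro!: mult_le_mono)
    then show ?thesis using that(5) by linarith
  qed
  show "quads n \<subseteq> {..n} \<times> {..n} \<times> {..n} \<times> {..n}"
    unfolding quads_def using * by auto
qed simp

text \<open>Split the first sum by comparing \<open>x\<close> with \<open>y\<close> and the second
  by comparing \<open>a\<close> with \<open>b\<close>. The shear matches \<open>x < y\<close> with
  \<open>a > b\<close>, and exchanging the two pairs, which \<open>sym\<close> and
  \<open>refl\<close> allow, matches the opposite inequalities, so only the diagonals survive. On
  \<open>x = y\<close> the divisor is \<open>N = a + b\<close>; on \<open>a = b\<close> it is
  \<open>N = a\<close>, with \<open>n div N - 1\<close> choices of \<open>x\<close>.\<close>

lemma sum_quads_symmetric:
  fixes r :: "nat \<Rightarrow> nat \<Rightarrow> rat"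
  assumes n: "n > 0"
    and sym: "\<And>a b. r a b = r b a"
    and refl: "\<And>a b. r (a + b) a = r (a + b) b"
  shows "(\<Sum>(a, b, x, y)\<in>quads n. r (a + b) b - r a b) =
    (\<Sum>N | N dvd n. (\<Sum>b\<in>{1..<N}. r N b) - of_nat (n div N - 1) * r N N)"
proof -
  let ?s = "\<lambda>P. (\<Sum>(a, b, x, y)\<in>{q\<in>quads n. case q of (a, b, x, y) \<Rightarrow> P a b x y}. r (a + b) b)"
  let ?t = "\<lambda>P. (\<Sum>(a, b, x, y)\<in>{q\<in>quads n. case q of (a, b, x, y) \<Rightarrow> P a b x y}. r a b)"
  have split: "sum h A = sum h {q\<in>A. u q < v q} + sum h {q\<in>A. v q < u q} + sum h {q\<in>A. u q = v q}"
    if "finite A" for h :: "'a \<Rightarrow> rat" and A and u v :: "'a \<Rightarrow> nat"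
    unfolding sum.inter_filter[OF that] sum.distrib[symmetric]
    by (intro sum.cong) auto
  have split_s: "(\<Sum>(a, b, x, y)\<in>quads n. r (a + b) b) =
      ?s (\<lambda>a b x y. x < y) + ?s (\<lambda>a b x y. x > y) + ?s (\<lambda>a b x y. x = y)"
    using split[of "quads n" "\<lambda>(a, b, x, y). r (a + b) b" "\<lambda>(a, b, x, y). x" "\<lambda>(a, b, x, y). y"]
    by (simp add: case_prod_unfold)
  have split_t: "(\<Sum>(a, b, x, y)\<in>quads n. r a b) =
      ?t (\<lambda>a b x y. a > b) + ?t (\<lambda>a b x y. a < b) + ?t (\<lambda>a b x y. a = b)"
    using split[of "quads n" "\<lambda>(a, b, x, y). r a b" "\<lambda>(a, b, x, y). b" "\<lambda>(a, b, x, y). a"]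
    by (simp add: case_prod_unfold eq_commute)
  have shear: "?s (\<lambda>a b x y. x < y) = ?t (\<lambda>a b x y. a > b)"
    by (rule sum.reindex_bij_witness[where i = "\<lambda>(a, b, x, y). (a - b, b, x, x + y)"
          and j = "\<lambda>(a, b, x, y). (a + b, b, x, y - x)"])
      (auto simp: quads_def algebra_simps diff_mult_distrib2 less_imp_le
        intro!: le_add_diff_inverse trans_le_add1 mult_le_mono)
  have swap_s: "?s (\<lambda>a b x y. x > y) = ?s (\<lambda>a b x y. x < y)"
    by (rule sum.reindex_bij_witness[where i = "\<lambda>(a, b, x, y). (b, a, y, x)"
          and j = "\<lambda>(a, b, x, y). (b, a, y, x)"])
      (use refl in \<open>auto simp: quads_def add.commute\<close>)
  have swap_t: "?t (\<lambda>a b x y. a < b) = ?t (\<lambda>a b x y. a > b)"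
    by (rule sum.reindex_bij_witness[where i = "\<lambda>(a, b, x, y). (b, a, y, x)"
          and j = "\<lambda>(a, b, x, y). (b, a, y, x)"])
      (use sym in \<open>auto simp: quads_def add.commute\<close>)
  have findvd: "finite {N. N dvd n}" using n by (simp add: finite_divisors_nat)
  have diag_s: "?s (\<lambda>a b x y. x = y) = (\<Sum>N | N dvd n. \<Sum>b\<in>{1..<N}. r N b)"
  proof -
    have "?s (\<lambda>a b x y. x = y) = (\<Sum>(N, b)\<in>(SIGMA N:{N. N dvd n}. {1..<N}). r N b)"
    proof (rule sum.reindex_bij_witness[where i = "\<lambda>(N, b). (N - b, b, n div N, n div N)"
          and j = "\<lambda>(a, b, x, y). (a + b, b)"], goal_cases)
      case (1 q) then show ?case
        by (auto simp: quads_def simp flip: add_mult_distrib)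
    next
      case (2 q) then show ?case
        by (auto simp: quads_def simp flip: add_mult_distrib)
    next
      case (3 q) then show ?case by auto
    next
      case (4 q)
      then obtain N b where q: "q = (N, b)" "N dvd n" "1 \<le> b" "b < N" by auto
      then have "(N - b) * (n div N) + b * (n div N) = n"
        by (simp flip: add_mult_distrib)
      then show ?case using q n by (auto simp: quads_def div_greater_zero_iff dvd_imp_le)
    next
      case (5 q) then show ?case by auto
    qed
    also have "\<dots> = (\<Sum>N | N dvd n. \<Sum>b\<in>{1..<N}. r N b)"
      by (rule sum.Sigma[symmetric]) (use findvd in auto)
    finally show ?thesis .
  qed
  have diag_t: "?t (\<lambda>a b x y. a = b) = (\<Sum>N | N dvd n. of_nat (n div N - 1) * r N N)"
  proof -
    have "?t (\<lambda>a b x y. a = b) =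
      (\<Sum>(N, x)\<in>(SIGMA N:{N. N dvd n}. {1..<n div N}). r N N)"
    proof (rule sum.reindex_bij_witness[where i = "\<lambda>(N, x). (N, N, x, n div N - x)"
          and j = "\<lambda>(a, b, x, y). (a, x)"], goal_cases)
      case (1 q) then show ?case
        by (auto simp: quads_def simp flip: add_mult_distrib2)
    next
      case (2 q) then show ?case
        by (auto simp: quads_def simp flip: add_mult_distrib2)
    next
      case (3 q) then show ?case by auto
    next
      case (4 q)
      then obtain N x where q: "q = (N, x)" "N dvd n" "1 \<le> x" "x < n div N" by auto
      then have "N * x + N * (n div N - x) = n"
        by (simp flip: add_mult_distrib2)
      then show ?case using q n by (auto simp: quads_def intro: Nat.gr0I)
    next
      case (5 q) then show ?case by auto
    qed
    also have "\<dots> = (\<Sum>N | N dvd n. \<Sum>x\<in>{1..<n div N}. r N N)"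
      by (rule sum.Sigma[symmetric]) (use findvd in auto)
    also have "\<dots> = (\<Sum>N | N dvd n. of_nat (n div N - 1) * r N N)" by simp
    finally show ?thesis .
  qed
  have "(\<Sum>(a, b, x, y)\<in>quads n. r (a + b) b - r a b) =
    (\<Sum>(a, b, x, y)\<in>quads n. r (a + b) b) - (\<Sum>(a, b, x, y)\<in>quads n. r a b)"
    by (simp add: case_prod_unfold sum_subtractf)
  also have "\<dots> = ?s (\<lambda>a b x y. x = y) - ?t (\<lambda>a b x y. a = b)"
    unfolding split_s split_t swap_s swap_t shear by (rule add_diff_cancel_left)
  finally show ?thesis unfolding diag_s diag_t by (simp add: sum_subtractf)
qed

text \<open>A divisor \<open>a\<close> of \<open>m\<close> and a divisor \<open>b\<close> of
  \<open>n - m\<close> are completed by their cofactors \<open>x\<close> and \<open>y\<close>;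
  conversely \<open>m = a * x\<close>.\<close>

lemma sigma_fps_mult_nth:
  "fps_nth (sigma_fps i * sigma_fps j) n =
    (\<Sum>(a, b, x, y)\<in>quads n. of_nat a ^ i * of_nat b ^ j)"
proof -
  have fd: "finite {d. d dvd m}" if "m > 0" for m :: nat using that by (simp add: finite_divisors_nat)
  have "fps_nth (sigma_fps i * sigma_fps j) n =
      (\<Sum>m = 0..n. fps_nth (sigma_fps i) m * fps_nth (sigma_fps j) (n - m))"
    by (rule fps_mult_nth)
  also have "\<dots> = (\<Sum>m\<in>{0<..<n}. fps_nth (sigma_fps i) m * fps_nth (sigma_fps j) (n - m))"
    by (rule sum.mono_neutral_right) (auto simp: sigma_fps_def)
  also have "\<dots> = (\<Sum>m\<in>{0<..<n}. \<Sum>(a, b)\<in>{a. a dvd m} \<times> {b. b dvd (n - m)}.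
      of_nat a ^ i * of_nat b ^ j)"
    by (intro sum.cong refl)
      (simp add: sigma_fps_def divisor_sigma_def sum_product sum.cartesian_product)
  also have "\<dots> = (\<Sum>(m, a, b)\<in>(SIGMA m:{0<..<n}. {a. a dvd m} \<times> {b. b dvd (n - m)}).
      of_nat a ^ i * of_nat b ^ j)"
    by (subst sum.Sigma) (use fd in \<open>auto simp: case_prod_unfold\<close>)
  also have "\<dots> = (\<Sum>(a, b, x, y)\<in>quads n. of_nat a ^ i * of_nat b ^ j)"
  proof (rule sum.reindex_bij_witness[where i = "\<lambda>(a, b, x, y). (a * x, a, b)"
          and j = "\<lambda>(m, a, b). (a, b, m div a, (n - m) div b)"], goal_cases)
    case (1 q) then show ?case by (auto simp: quads_def)
  next
    case (2 q)
    then obtain m a b where q: "q = (m, a, b)" "0 < m" "m < n" "a dvd m" "b dvd n - m" by auto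
    then have "a > 0" "b > 0" "a \<le> m" "b \<le> n - m"
      using dvd_pos_nat[of "n - m" b] dvd_pos_nat[of m a] by (auto dest: dvd_imp_le)
    then show ?case using q by (auto simp: quads_def div_greater_zero_iff)
  next
    case (3 q) then show ?case by (auto simp: quads_def)
  next
    case (4 q) then show ?case by (auto simp: quads_def)
  next
    case (5 q) then show ?case by auto
  qed
  finally show ?thesis .
qed

section \<open>Quasi-modular forms and their derivatives\<close>

text \<open>Only the constant term has to vanish: \<open>sigma_fps 1\<close> belongs here, although
  it is no cusp form in the classical sense.\<close>

definition cusp_quasi_modular :: "rat fps set"
  where "cusp_quasi_modular = {f \<in> quasi_modular. fps_nth f 0 = 0}"

lemma quasi_modular_scale:
  "f \<in> quasi_modular \<Longrightarrow> fps_const c * f \<in> quasi_modular"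
  by (intro quasi_modular.intros)

lemma quasi_modular_uminus: "f \<in> quasi_modular \<Longrightarrow> - f \<in> quasi_modular"
  using quasi_modular_scale[of f "-1"] by (simp flip: fps_const_neg)

lemma quasi_modular_diff:
  "f \<in> quasi_modular \<Longrightarrow> h \<in> quasi_modular \<Longrightarrow> f - h \<in> quasi_modular"
  using quasi_modular.add[OF _ quasi_modular_uminus, of f h] by simp

lemma quasi_modular_0: "0 \<in> quasi_modular" and quasi_modular_1: "1 \<in> quasi_modular"
  using quasi_modular.const[of 0] quasi_modular.const[of 1] by simp_all

lemma quasi_modular_sum: "(\<And>i. i \<in> I \<Longrightarrow> f i \<in> quasi_modular) \<Longrightarrow> sum f I \<in> quasi_modular"
  by (induction I rule: infinite_finite_induct) (auto intro: quasi_modular_0 quasi_modular.add)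

lemma quasi_modular_scale_iff:
  assumes "c \<noteq> 0"
  shows "fps_const c * f \<in> quasi_modular \<longleftrightarrow> f \<in> quasi_modular"
proof
  assume "fps_const c * f \<in> quasi_modular"
  then have "fps_const (inverse c) * (fps_const c * f) \<in> quasi_modular"
    by (rule quasi_modular_scale)
  then show "f \<in> quasi_modular" using assms by (simp flip: mult.assoc)
qed (rule quasi_modular_scale)

lemma cusp_quasi_modular_0: "0 \<in> cusp_quasi_modular"
  and cusp_quasi_modular_add:
    "f \<in> cusp_quasi_modular \<Longrightarrow> h \<in> cusp_quasi_modular \<Longrightarrow> f + h \<in> cusp_quasi_modular"
  and cusp_quasi_modular_mult:
    "f \<in> cusp_quasi_modular \<Longrightarrow> h \<in> cusp_quasi_modular \<Longrightarrow> f * h \<in> cusp_quasi_modular"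
  and cusp_quasi_modular_scale:
    "f \<in> cusp_quasi_modular \<Longrightarrow> fps_const c * f \<in> cusp_quasi_modular"
  by (auto simp: cusp_quasi_modular_def intro: quasi_modular_0 quasi_modular.intros)

lemma cusp_quasi_modular_sum:
  "(\<And>i. i \<in> I \<Longrightarrow> f i \<in> cusp_quasi_modular) \<Longrightarrow> sum f I \<in> cusp_quasi_modular"
  by (induction I rule: infinite_finite_induct)
    (auto intro: cusp_quasi_modular_0 cusp_quasi_modular_add)

text \<open>\<open>lambert f\<close> is the Lambert series \<open>\<Sum>N\<ge>1. f N * x^N / (1 - x^N)\<close>.\<close>

definition lambert :: "(nat \<Rightarrow> rat) \<Rightarrow> rat fps"
  where "lambert f = Abs_fps (\<lambda>n. if n = 0 then 0 else \<Sum>N | N dvd n. f N)"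

lemma lambert_cong: "(\<And>N. N > 0 \<Longrightarrow> f N = h N) \<Longrightarrow> lambert f = lambert h"
  unfolding lambert_def fps_eq_iff
  by (auto intro!: sum.cong dest: dvd_pos_nat)

lemma lambert_add: "lambert (\<lambda>N. f N + h N) = lambert f + lambert h"
  and lambert_scale: "lambert (\<lambda>N. c * f N) = fps_const c * lambert f"
  by (auto simp: lambert_def fps_eq_iff sum.distrib sum_distrib_left)

lemma lambert_sum: "lambert (\<lambda>N. \<Sum>i\<in>I. f i N) = (\<Sum>i\<in>I. lambert (f i))"
  by (auto simp: lambert_def fps_eq_iff fps_sum_nth intro: sum.swap)

lemma lambert_power: "lambert (\<lambda>N. of_nat N ^ k) = sigma_fps k"
  by (simp add: lambert_def sigma_fps_def divisor_sigma_def fps_eq_iff)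

lemma sigma_fps_1_3_5:
  "sigma_fps 1 \<in> quasi_modular" "sigma_fps 3 \<in> quasi_modular" "sigma_fps 5 \<in> quasi_modular"
proof -
  have "fps_const (- 24) * sigma_fps 1 = E2 - 1" "fps_const 240 * sigma_fps 3 = E4 - 1"
    "fps_const (- 504) * sigma_fps 5 = E6 - 1"
    unfolding E2_def E4_def E6_def sigma_fps_def
    by (simp_all add: numeral_fps_const flip: fps_const_neg)
  then have "fps_const (- 24) * sigma_fps 1 \<in> quasi_modular"
    "fps_const 240 * sigma_fps 3 \<in> quasi_modular" "fps_const (- 504) * sigma_fps 5 \<in> quasi_modular"
    using quasi_modular.E2 quasi_modular.E4 quasi_modular.E6 quasi_modular_1 quasi_modular_diff
    by metis+
  then show "sigma_fps 1 \<in> quasi_modular" "sigma_fps 3 \<in> quasi_modular" "sigma_fps 5 \<in> quasi_modular"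
    by (simp_all add: quasi_modular_scale_iff)
qed

section \<open>The identity \<open>E_8 = E_4^2\<close> in terms of divisor sums\<close>

lemma sum_squares_product:
  "(\<Sum>b\<in>{1..<N}. of_nat N ^ 2 * of_nat b ^ 2 * of_nat (N - b) ^ 2 :: rat) =
    (of_nat N ^ 7 - of_nat N ^ 3) / 30"
proof -
  \<comment> \<open>\<open>X\<close> is kept apart from the bound \<open>M\<close>, so that the
    summand stays fixed in the induction; afterwards both become \<open>N\<close>.\<close>
  have *: "(\<Sum>b<M. (of_nat b)\<^sup>2 * (X - of_nat b)\<^sup>2 :: rat) =
     X\<^sup>2 * (of_nat M * (of_nat M - 1) * (2 * of_nat M - 1)) / 6
     - X * (of_nat M * (of_nat M - 1))\<^sup>2 / 2
     + of_nat M * (of_nat M - 1) * (2 * of_nat M - 1) * (3 * of_nat M ^ 2 - 3 * of_nat M - 1) / 30"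
    for M and X :: rat
    by (induction M) (auto simp: field_simps power2_eq_square)
  have "(\<Sum>b\<in>{1..<N}. of_nat N ^ 2 * of_nat b ^ 2 * of_nat (N - b) ^ 2 :: rat) =
    (\<Sum>b<N. of_nat N ^ 2 * of_nat b ^ 2 * of_nat (N - b) ^ 2)"
    by (rule sum.mono_neutral_left) (auto simp: not_le)
  also have "\<dots> = of_nat N ^ 2 * (\<Sum>b<N. (of_nat b)\<^sup>2 * (of_nat N - of_nat b)\<^sup>2 :: rat)"
    by (auto simp: sum_distrib_left of_nat_diff algebra_simps intro!: sum.cong)
  also have "\<dots> = (of_nat N ^ 7 - of_nat N ^ 3) / 30"
    unfolding * by (simp add: field_simps power_numeral_reduce)
  finally show ?thesis .
qed

text \<open>The polynomial \<open>r\<close> has the required symmetries,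
  \<open>r (a + b) b - r a b = 4 * a^3 * b^3\<close>, and \<open>r N N = 0\<close>. The identity
  supplies \<open>sigma_fps 7\<close> independently of the differential identities below, which
  alone would only tie it to the derivative of \<open>sigma_fps 5\<close>.\<close>

lemma sigma_fps_7: "sigma_fps 7 = fps_const 120 * sigma_fps 3 ^ 2 + sigma_fps 3"
proof (rule fps_ext)
  fix n
  show "fps_nth (sigma_fps 7) n = fps_nth (fps_const 120 * sigma_fps 3 ^ 2 + sigma_fps 3) n"
  proof (cases "n = 0")
    case False
    define r :: "nat \<Rightarrow> nat \<Rightarrow> rat"
      where "r a b = of_nat a ^ 2 * of_nat b ^ 2 * (of_nat a - of_nat b) ^ 2" for a b
    have "4 * fps_nth (sigma_fps 3 ^ 2) n = (\<Sum>(a, b, x, y)\<in>quads n. r (a + b) b - r a b)"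
      unfolding power2_eq_square sigma_fps_mult_nth r_def sum_distrib_left
      by (intro sum.cong) (auto simp: algebra_simps power_numeral_reduce)
    also have "\<dots> = (\<Sum>N | N dvd n. (\<Sum>b\<in>{1..<N}. r N b) - of_nat (n div N - 1) * r N N)"
      by (rule sum_quads_symmetric) (use False in \<open>auto simp: r_def power2_eq_square algebra_simps\<close>)
    also have "\<dots> = (\<Sum>N | N dvd n. (of_nat N ^ 7 - of_nat N ^ 3) / 30)"
      unfolding sum_squares_product[symmetric] r_def
      by (intro sum.cong refl) (auto simp: of_nat_diff intro!: sum.cong)
    also have "\<dots> = (fps_nth (sigma_fps 7) n - fps_nth (sigma_fps 3) n) / 30"
      using False
      by (simp add: sigma_fps_def divisor_sigma_def sum_subtractf flip: sum_divide_distrib)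
    finally show ?thesis by simp
  qed (simp add: sigma_fps_def power2_eq_square)
qed

section \<open>Power sums and the differential identities between Eisenstein series\<close>

text \<open>Twice the trapezoidal sum of \<open>b^(2m)\<close>; unlike \<open>\<Sum>b<N. b^(2m)\<close> it is an odd
  polynomial in \<open>N\<close>.\<close>

definition trapezoid :: "nat \<Rightarrow> nat \<Rightarrow> rat"
  where "trapezoid m N = 2 * (\<Sum>b\<in>{1..<N}. of_nat b ^ (2 * m)) + of_nat N ^ (2 * m) + 0 ^ (2 * m)"

lemma odd_power_add_diff:
  fixes x y :: "'a :: comm_ring_1"
  shows "(x + y) ^ (2 * m + 1) - (x - y) ^ (2 * m + 1) =
      (\<Sum>j\<le>m. of_nat (2 * (2 * m + 1 choose (2 * j))) * x ^ (2 * j) * y ^ (2 * m + 1 - 2 * j))"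
    and "(x + y) ^ (2 * m + 1) + (x - y) ^ (2 * m + 1) =
      (\<Sum>j\<le>m. of_nat (2 * (2 * m + 1 choose (2 * j + 1))) * x ^ (2 * j + 1) * y ^ (2 * m - 2 * j))"
proof -
  define c :: "nat \<Rightarrow> 'a" where "c k = of_nat (2 * m + 1 choose k)" for k
  have expand: "(x + z) ^ (2 * m + 1) = (\<Sum>j\<le>m. c (2 * j) * x ^ (2 * j) * z ^ (2 * m + 1 - 2 * j) +
      c (2 * j + 1) * x ^ (2 * j + 1) * z ^ (2 * m - 2 * j))" for z
    using binomial_ring[of x z "2 * m + 1"] sum.in_pairs_0[of "\<lambda>k. c k * x ^ k * z ^ (2 * m + 1 - k)" m]
    by (simp add: c_def del: binomial_Suc_Suc)
  have neg: "(x - y) ^ (2 * m + 1) = (\<Sum>j\<le>m. c (2 * j + 1) * x ^ (2 * j + 1) * y ^ (2 * m - 2 * j) -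
      c (2 * j) * x ^ (2 * j) * y ^ (2 * m + 1 - 2 * j))"
    unfolding diff_conv_add_uminus[of x y] expand by (intro sum.cong refl) simp
  show "(x + y) ^ (2 * m + 1) - (x - y) ^ (2 * m + 1) =
      (\<Sum>j\<le>m. of_nat (2 * (2 * m + 1 choose (2 * j))) * x ^ (2 * j) * y ^ (2 * m + 1 - 2 * j))"
    unfolding neg expand of_nat_mult c_def[symmetric] sum_subtractf[symmetric]
    by (intro sum.cong refl) (simp add: algebra_simps)
  show "(x + y) ^ (2 * m + 1) + (x - y) ^ (2 * m + 1) =
      (\<Sum>j\<le>m. of_nat (2 * (2 * m + 1 choose (2 * j + 1))) * x ^ (2 * j + 1) * y ^ (2 * m - 2 * j))"
    unfolding neg expand of_nat_mult c_def[symmetric] sum.distrib[symmetric]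
    by (intro sum.cong refl) (simp add: algebra_simps)
qed

lemma even_power_add_diff:
  fixes x y :: "'a :: comm_ring_1"
  assumes "m > 0"
  shows "(x + y) ^ (2 * m) - (x - y) ^ (2 * m) =
    (\<Sum>j<m. of_nat (2 * (2 * m choose (2 * j + 1))) * x ^ (2 * j + 1) * y ^ (2 * m - 1 - 2 * j))"
proof -
  define c :: "nat \<Rightarrow> 'a" where "c k = of_nat (2 * m choose k)" for k
  have expand: "(x + z) ^ (2 * m) = (\<Sum>j<m. c (2 * j) * x ^ (2 * j) * z ^ (2 * m - 2 * j) +
      c (2 * j + 1) * x ^ (2 * j + 1) * z ^ (2 * m - 1 - 2 * j)) + c (2 * m) * x ^ (2 * m)" for z
  proof -
    obtain l where l: "m = Suc l" using assms gr0_implies_Suc by blast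
    have "(x + z) ^ (2 * m) = (\<Sum>k\<le>2 * m. c k * x ^ k * z ^ (2 * m - k))"
      by (simp add: binomial_ring c_def)
    also have "\<dots> = (\<Sum>k\<le>Suc (2 * l). c k * x ^ k * z ^ (2 * m - k)) + c (2 * m) * x ^ (2 * m)"
      by (simp add: l)
    also have "\<dots> = (\<Sum>j<m. c (2 * j) * x ^ (2 * j) * z ^ (2 * m - 2 * j) +
      c (2 * j + 1) * x ^ (2 * j + 1) * z ^ (2 * m - 1 - 2 * j)) + c (2 * m) * x ^ (2 * m)"
      unfolding sum.in_pairs_0 using l by (simp add: lessThan_Suc_atMost)
    finally show ?thesis .
  qed
  have neg: "(x - y) ^ (2 * m) = (\<Sum>j<m. c (2 * j) * x ^ (2 * j) * y ^ (2 * m - 2 * j) -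
      c (2 * j + 1) * x ^ (2 * j + 1) * y ^ (2 * m - 1 - 2 * j)) + c (2 * m) * x ^ (2 * m)"
    unfolding diff_conv_add_uminus[of x y] expand
    by (intro arg_cong2[of _ _ _ _ "(+)"] sum.cong refl) auto
  show ?thesis
    unfolding neg expand of_nat_mult c_def[symmetric] add_diff_cancel_right sum_subtractf[symmetric]
    by (intro sum.cong refl) (simp add: algebra_simps)
qed

text \<open>Telescoping \<open>(b + 1)^(2m+1) - (b - 1)^(2m+1)\<close> over \<open>0 < b < N\<close>
  leaves a power of \<open>N - 1\<close>. The endpoint terms of the trapezoidal sums turn it into
  the mean of the powers of \<open>N + 1\<close> and \<open>N - 1\<close>, in which only odd powers
  of \<open>N\<close> occur.\<close>

lemma trapezoid_recurrence:
  assumes "N > 0"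
  shows "(\<Sum>j\<le>m. of_nat (2 * m + 1 choose (2 * j)) * trapezoid j N) =
    of_nat N ^ (2 * m + 1) + (\<Sum>j\<le>m. of_nat (2 * m + 1 choose (2 * j + 1)) * of_nat N ^ (2 * j + 1))"
proof -
  let ?k = "2 * m + 1" and ?c = "\<lambda>j. of_nat (2 * m + 1 choose (2 * j)) :: rat"
  have tele: "(\<Sum>b\<in>{1..<Suc M}. (of_nat b + 1) ^ ?k - (of_nat b - 1) ^ ?k :: rat) =
      of_nat (Suc M) ^ ?k + of_nat M ^ ?k - 1" for M
    by (induction M) (simp_all add: algebra_simps)
  have "(\<Sum>j\<le>m. ?c j * (2 * (\<Sum>b\<in>{1..<N}. of_nat b ^ (2 * j)))) =
      (\<Sum>b\<in>{1..<N}. \<Sum>j\<le>m. of_nat (2 * (?k choose (2 * j))) * of_nat b ^ (2 * j))"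
    by (subst sum.swap) (simp add: sum_distrib_left mult_ac)
  also have "\<dots> = (\<Sum>b\<in>{1..<N}. (of_nat b + 1) ^ ?k - (of_nat b - 1) ^ ?k)"
    by (simp only: odd_power_add_diff power_one mult_1_right)
  also have "\<dots> = of_nat N ^ ?k + (of_nat N - 1) ^ ?k - 1"
    using tele[of "N - 1"] assms by (simp add: of_nat_diff)
  finally have inner: "(\<Sum>j\<le>m. ?c j * (2 * (\<Sum>b\<in>{1..<N}. of_nat b ^ (2 * j)))) =
    of_nat N ^ ?k + (of_nat N - 1) ^ ?k - 1" .
  have "2 * (\<Sum>j\<le>m. ?c j * of_nat N ^ (2 * j)) = (of_nat N + 1) ^ ?k - (of_nat N - 1) ^ ?k"
    by (simp only: odd_power_add_diff power_one mult_1_right sum_distrib_left of_nat_mult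
        of_nat_numeral mult.assoc)
  moreover have "2 * (\<Sum>j\<le>m. of_nat (?k choose (2 * j + 1)) * of_nat N ^ (2 * j + 1)) =
      (of_nat N + 1) ^ ?k + (of_nat N - 1 :: rat) ^ ?k"
    by (simp only: odd_power_add_diff power_one mult_1_right sum_distrib_left of_nat_mult
        of_nat_numeral mult.assoc)
  \<comment> \<open>Only \<open>j = 0\<close> contributes, through \<open>0 ^ 0 = 1\<close>; this
    cancels the \<open>- 1\<close> of the telescoped sum.\<close>
  moreover have "(\<Sum>j\<le>m. ?c j * 0 ^ (2 * j)) = 1"
    by (subst sum.atMost_shift) simp
  moreover have "(\<Sum>j\<le>m. ?c j * trapezoid j N) =
      (\<Sum>j\<le>m. ?c j * (2 * (\<Sum>b\<in>{1..<N}. of_nat b ^ (2 * j)))) +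
      (\<Sum>j\<le>m. ?c j * of_nat N ^ (2 * j)) + (\<Sum>j\<le>m. ?c j * 0 ^ (2 * j))"
    unfolding trapezoid_def by (simp only: distrib_left sum.distrib)
  ultimately show ?thesis using inner by linarith
qed

text \<open>Faulhaber's formula with its leading term made explicit; the recurrence replaces the
  Bernoulli numbers. For \<open>j = m\<close> the trapezoid has coefficient
  \<open>2 * m + 1\<close>, and the power \<open>N ^ (2 * m + 1)\<close> occurs twice on the other
  side, whence the constant \<open>2 / (2 * m + 1)\<close>. All remaining terms have smaller
  index.\<close>

lemma lambert_trapezoid:
  assumes "\<And>j. j < m \<Longrightarrow> sigma_fps (2 * j + 1) \<in> quasi_modular"
  shows "lambert (trapezoid m) - fps_const (2 / of_nat (2 * m + 1)) * sigma_fps (2 * m + 1)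
    \<in> quasi_modular"
  using assms
proof (induction m rule: less_induct)
  case (less m)
  let ?k = "2 * m + 1"
  let ?S = "\<lambda>j. sigma_fps (2 * j + 1)" and ?L = "\<lambda>j. lambert (trapezoid j)"
  have L: "?L j \<in> quasi_modular" if "j < m" for j
  proof -
    have "?L j - fps_const (2 / of_nat (2 * j + 1)) * ?S j \<in> quasi_modular"
      by (rule less.IH) (use that less.prems in auto)
    moreover have "fps_const (2 / of_nat (2 * j + 1)) * ?S j \<in> quasi_modular"
      by (rule quasi_modular_scale[OF less.prems[OF that]])
    ultimately have "(?L j - fps_const (2 / of_nat (2 * j + 1)) * ?S j) +
      fps_const (2 / of_nat (2 * j + 1)) * ?S j \<in> quasi_modular"
      by (rule quasi_modular.add)
    then show ?thesis by simp
  qed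
  have "(\<Sum>j\<le>m. fps_const (of_nat (?k choose (2 * j))) * ?L j) =
      lambert (\<lambda>N. \<Sum>j\<le>m. of_nat (?k choose (2 * j)) * trapezoid j N)"
    by (simp only: lambert_sum lambert_scale)
  also have "\<dots> = lambert (\<lambda>N. of_nat N ^ ?k + (\<Sum>j\<le>m. of_nat (?k choose (2 * j + 1)) * of_nat N ^ (2 * j + 1)))"
    by (rule lambert_cong) (rule trapezoid_recurrence)
  also have "\<dots> = ?S m + (\<Sum>j\<le>m. fps_const (of_nat (?k choose (2 * j + 1))) * ?S j)"
    by (simp only: lambert_add lambert_sum lambert_scale lambert_power)
  finally have "fps_const (of_nat ?k) * ?L m = 2 * ?S m +
      ((\<Sum>j<m. fps_const (of_nat (?k choose (2 * j + 1))) * ?S j) -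
      (\<Sum>j<m. fps_const (of_nat (?k choose (2 * j))) * ?L j))"
    by (simp add: lessThan_Suc_atMost[symmetric] algebra_simps del: of_nat_Suc of_nat_add of_nat_mult)
  moreover have "fps_const (of_nat ?k) * (fps_const (2 / of_nat ?k) * ?S m) = 2 * ?S m"
    by (simp add: numeral_fps_const flip: mult.assoc del: of_nat_Suc of_nat_add of_nat_mult)
  ultimately have "fps_const (of_nat ?k) * (?L m - fps_const (2 / of_nat ?k) * ?S m) =
      (\<Sum>j<m. fps_const (of_nat (?k choose (2 * j + 1))) * ?S j) -
      (\<Sum>j<m. fps_const (of_nat (?k choose (2 * j))) * ?L j)"
    by (simp only: right_diff_distrib) simp
  also have "\<dots> \<in> quasi_modular"
    by (intro quasi_modular_diff quasi_modular_sum quasi_modular_scale L less.prems) auto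
  finally show ?case
    by (subst (asm) quasi_modular_scale_iff) (simp del: of_nat_add of_nat_mult, simp_all)
qed

text \<open>Here \<open>r (a + b) b - r a b = (a + b)^(2m) - (a - b)^(2m)\<close>, which contains
  only products of odd powers. In the diagonal terms, \<open>n div N\<close> times
  \<open>N ^ (2 * m)\<close> is \<open>n * N ^ (2 * m - 1)\<close>, and the factor \<open>n\<close>
  is what \<open>theta\<close> produces.\<close>

lemma sigma_fps_differential:
  assumes "m > 0"
  shows "(\<Sum>j<m. fps_const (of_nat (2 * (2 * m choose (2 * j + 1)))) *
      (sigma_fps (2 * j + 1) * sigma_fps (2 * m - 1 - 2 * j))) =
    sigma_fps (2 * m + 1) + lambert (trapezoid m) - 2 * theta (sigma_fps (2 * m - 1))"
proof (rule fps_ext)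
  fix n
  define r :: "nat \<Rightarrow> nat \<Rightarrow> rat"
    where "r a b = of_nat a ^ (2 * m) + of_nat b ^ (2 * m) + (of_nat a - of_nat b) ^ (2 * m)" for a b
  have diag: "(\<Sum>b\<in>{1..<N}. r N b) - of_nat (n div N - 1) * r N N =
      of_nat N ^ (2 * m + 1) + trapezoid m N - 2 * (of_nat n * of_nat N ^ (2 * m - 1))"
    if dvd: "N dvd n" and n: "n > 0" for N
  proof -
    have N: "N > 0" using that by (auto dest: dvd_pos_nat)
    have "(\<Sum>b\<in>{1..<N}. (of_nat N - of_nat b) ^ (2 * m) :: rat) = (\<Sum>b\<in>{1..<N}. of_nat b ^ (2 * m))"
      by (rule sum.reindex_bij_witness[where i = "\<lambda>b. N - b" and j = "\<lambda>b. N - b"])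
        (auto simp: of_nat_diff)
    then have 1: "(\<Sum>b\<in>{1..<N}. r N b) = (of_nat N - 1) * of_nat N ^ (2 * m) +
        2 * (\<Sum>b\<in>{1..<N}. of_nat b ^ (2 * m))"
      using N by (simp add: r_def sum.distrib of_nat_diff)
    obtain e where e: "n = N * e" using dvd by (rule dvdE)
    then have "e > 0" using n by auto
    have "(of_nat N :: rat) ^ (2 * m) = of_nat N * of_nat N ^ (2 * m - 1)"
      using assms by (simp flip: power_Suc)
    then have "of_nat (n div N - 1) * r N N =
        2 * (of_nat n * of_nat N ^ (2 * m - 1)) - 2 * of_nat N ^ (2 * m)"
      using e \<open>e > 0\<close> N assms by (simp add: r_def of_nat_diff algebra_simps)
    then show ?thesis
      unfolding 1 trapezoid_def using assms by (simp add: algebra_simps)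
  qed
  show "fps_nth (\<Sum>j<m. fps_const (of_nat (2 * (2 * m choose (2 * j + 1)))) *
      (sigma_fps (2 * j + 1) * sigma_fps (2 * m - 1 - 2 * j))) n =
    fps_nth (sigma_fps (2 * m + 1) + lambert (trapezoid m) - 2 * theta (sigma_fps (2 * m - 1))) n"
  proof (cases "n = 0")
    case False
    have "fps_nth (\<Sum>j<m. fps_const (of_nat (2 * (2 * m choose (2 * j + 1)))) *
        (sigma_fps (2 * j + 1) * sigma_fps (2 * m - 1 - 2 * j))) n =
      (\<Sum>j<m. \<Sum>(a, b, x, y)\<in>quads n. of_nat (2 * (2 * m choose (2 * j + 1))) *
        of_nat a ^ (2 * j + 1) * of_nat b ^ (2 * m - 1 - 2 * j))"
      by (simp only: fps_sum_nth fps_mult_left_const_nth sigma_fps_mult_nth sum_distrib_left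
          case_prod_unfold mult.assoc)
    also have "\<dots> = (\<Sum>(a, b, x, y)\<in>quads n. r (a + b) b - r a b)"
      unfolding case_prod_unfold
      by (subst sum.swap, intro sum.cong refl, subst even_power_add_diff[OF assms, symmetric])
        (simp add: r_def)
    also have "\<dots> = (\<Sum>N | N dvd n. (\<Sum>b\<in>{1..<N}. r N b) - of_nat (n div N - 1) * r N N)"
    proof (rule sum_quads_symmetric)
      show "r a b = r b a" for a b
        unfolding r_def by (simp add: power_mult power2_commute[of "of_nat a"])
    qed (use False in \<open>auto simp: r_def\<close>)
    also have "\<dots> = (\<Sum>N | N dvd n. of_nat N ^ (2 * m + 1) + trapezoid m N -
        2 * (of_nat n * of_nat N ^ (2 * m - 1)))"
      using False by (intro sum.cong refl diag) auto
    also have "\<dots> = fps_nth (sigma_fps (2 * m + 1) + lambert (trapezoid m) - 2 * theta (sigma_fps (2 * m - 1))) n"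
      using False
      by (simp add: sum.distrib sum_subtractf numeral_fps_const theta_def lambert_def
          divisor_sigma_def sum_distrib_left flip: lambert_power)
    finally show ?thesis .
  qed (simp add: fps_sum_nth sigma_fps_def lambert_def theta_def numeral_fps_const)
qed

section \<open>Closure under \<open>theta\<close> and membership of all Eisenstein series\<close>

lemma theta_add: "theta (f + h) = theta f + theta h"
  and theta_mult: "theta (f * h) = theta f * h + f * theta h"
  and theta_scale: "theta (fps_const c * f) = fps_const c * theta f"
  and theta_const: "theta (fps_const c) = 0"
  by (simp_all add: theta_def algebra_simps)

text \<open>Modulo quasi-modular terms, \<open>sigma_fps_differential\<close> is a linear relation
  between the derivative and the next series, with nonzero coefficients \<open>2\<close> and
  \<open>1 + 2 / (2 * m + 1)\<close>. It can therefore be solved for either of them.\<close>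

lemma theta_sigma_fps_iff:
  assumes "m > 0" and S: "\<And>j. j < m \<Longrightarrow> sigma_fps (2 * j + 1) \<in> quasi_modular"
  shows "theta (sigma_fps (2 * m - 1)) \<in> quasi_modular \<longleftrightarrow> sigma_fps (2 * m + 1) \<in> quasi_modular"
proof -
  define c :: rat where "c = 1 + 2 / of_nat (2 * m + 1)"
  have c: "c \<noteq> 0" unfolding c_def by (simp add: add_pos_nonneg less_imp_neq[symmetric])
  define A where "A = (\<Sum>j<m. fps_const (of_nat (2 * (2 * m choose (2 * j + 1)))) *
      (sigma_fps (2 * j + 1) * sigma_fps (2 * m - 1 - 2 * j)))"
  define R where "R = lambert (trapezoid m) - fps_const (2 / of_nat (2 * m + 1)) * sigma_fps (2 * m + 1)"
  have S': "sigma_fps (2 * m - 1 - 2 * j) \<in> quasi_modular" if "j < m" for j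
  proof -
    have "2 * (m - 1 - j) + 1 = 2 * m - 1 - 2 * j" using that by simp
    then show ?thesis using S[of "m - 1 - j"] that by simp
  qed
  have A: "A \<in> quasi_modular"
    unfolding A_def
    by (intro quasi_modular_sum quasi_modular_scale quasi_modular.mult)
      (simp_all only: lessThan_iff S S')
  have R: "R \<in> quasi_modular" unfolding R_def by (rule lambert_trapezoid) (rule S)
  have eq: "fps_const c * sigma_fps (2 * m + 1) = fps_const 2 * theta (sigma_fps (2 * m - 1)) + (A - R)"
    unfolding A_def sigma_fps_differential[OF assms(1)] R_def c_def
    by (simp only: fps_const_add[symmetric] numeral_fps_const distrib_right) simp
  have "sigma_fps (2 * m + 1) \<in> quasi_modular \<longleftrightarrow> fps_const c * sigma_fps (2 * m + 1) \<in> quasi_modular"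
    by (simp add: quasi_modular_scale_iff c)
  also have "\<dots> \<longleftrightarrow> fps_const 2 * theta (sigma_fps (2 * m - 1)) \<in> quasi_modular"
  proof
    assume "fps_const c * sigma_fps (2 * m + 1) \<in> quasi_modular"
    from quasi_modular_diff[OF this quasi_modular_diff[OF A R]]
    show "fps_const 2 * theta (sigma_fps (2 * m - 1)) \<in> quasi_modular" unfolding eq by simp
  next
    assume "fps_const 2 * theta (sigma_fps (2 * m - 1)) \<in> quasi_modular"
    from quasi_modular.add[OF this quasi_modular_diff[OF A R]]
    show "fps_const c * sigma_fps (2 * m + 1) \<in> quasi_modular" unfolding eq .
  qed
  also have "\<dots> \<longleftrightarrow> theta (sigma_fps (2 * m - 1)) \<in> quasi_modular"
    by (simp add: quasi_modular_scale_iff)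
  finally show ?thesis by simp
qed

text \<open>Since \<open>sigma_fps 7\<close> is known to be quasi-modular, the cases
  \<open>m = 1, 2, 3\<close> of \<open>theta_sigma_fps_iff\<close> give the derivatives of the three
  generators; the Leibniz rule does the rest.\<close>

lemma theta_quasi_modular:
  assumes "f \<in> quasi_modular"
  shows "theta f \<in> quasi_modular"
proof -
  have S: "sigma_fps (2 * j + 1) \<in> quasi_modular" if "j < 4" for j
  proof -
    have "j \<in> {0, 1, 2, 3}" using that by auto
    moreover have "sigma_fps 7 \<in> quasi_modular"
      unfolding sigma_fps_7 power2_eq_square
      by (intro quasi_modular.intros sigma_fps_1_3_5)
    ultimately show ?thesis using sigma_fps_1_3_5 by auto
  qed
  have D: "theta (sigma_fps 1) \<in> quasi_modular" "theta (sigma_fps 3) \<in> quasi_modular"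
    "theta (sigma_fps 5) \<in> quasi_modular"
    using theta_sigma_fps_iff[of 1] theta_sigma_fps_iff[of 2] theta_sigma_fps_iff[of 3]
      S[of 0] S[of 1] S[of 2] S[of 3] S by auto
  have E: "E2 = 1 + fps_const (- 24) * sigma_fps 1" "E4 = 1 + fps_const 240 * sigma_fps 3"
    "E6 = 1 + fps_const (- 504) * sigma_fps 5"
    unfolding E2_def E4_def E6_def sigma_fps_def
    by (simp_all add: numeral_fps_const flip: fps_const_neg)
  from assms show ?thesis
  proof induction
    case (mult f h)
    then show ?case unfolding theta_mult by (intro quasi_modular.intros)
  qed (auto simp: E theta_add theta_scale theta_const theta_const[of 1, simplified]
      intro: quasi_modular_0 quasi_modular.add quasi_modular_scale D D[unfolded One_nat_def])
qed

text \<open>With closure under \<open>theta\<close> available, \<open>theta_sigma_fps_iff\<close> is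
  read in the other direction and climbs from each series to the next.\<close>

lemma sigma_fps_odd_quasi_modular: "sigma_fps (2 * m + 1) \<in> quasi_modular"
proof (induction m rule: less_induct)
  case (less m)
  show ?case
  proof (cases "m = 0")
    case False
    have "sigma_fps (2 * m - 1) \<in> quasi_modular"
    proof -
      have "2 * (m - 1) + 1 = 2 * m - 1" using False by simp
      then show ?thesis using less[of "m - 1"] False by simp
    qed
    then show ?thesis using theta_sigma_fps_iff[of m] less False theta_quasi_modular by blast
  qed (use sigma_fps_1_3_5 in simp)
qed

lemma theta_power_sigma_fps:
  assumes "odd k"
  shows "(theta ^^ c) (sigma_fps k) \<in> cusp_quasi_modular"
proof (induction c)
  case 0
  have "sigma_fps k \<in> quasi_modular"
    using assms sigma_fps_odd_quasi_modular by (auto elim!: oddE)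
  then show ?case by (simp add: cusp_quasi_modular_def) (simp add: sigma_fps_def)
next
  case (Suc c)
  then show ?case by (auto simp: cusp_quasi_modular_def theta_quasi_modular) (simp add: theta_def)
qed

section \<open>Moments of the series \<open>p\<close>\<close>

text \<open>The coefficient of \<open>x^i\<close> is a polynomial in \<open>t\<close> of degree at
  most \<open>2 * i\<close>, so that setting \<open>t = 1\<close> makes sense. The slope
  \<open>2\<close> is the one that \<open>P_tail\<close> satisfies.\<close>

definition tame :: "rat fps fps \<Rightarrow> bool"
  where "tame h \<longleftrightarrow> (\<forall>b i. 2 * i < b \<longrightarrow> fps_nth (fps_nth h b) i = 0)"

lemma tameD: "tame h \<Longrightarrow> fps_nth (fps_nth h b) i \<noteq> 0 \<Longrightarrow> b \<le> 2 * i"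
  by (meson not_le tame_def)

text \<open>The value at \<open>t = 1\<close> of a series in \<open>t\<close> with coefficients in the power series in \<open>x\<close>; the
  truncation of the sum is harmless for tame series.\<close>

definition eval_one :: "rat fps fps \<Rightarrow> rat fps"
  where "eval_one h = Abs_fps (\<lambda>i. \<Sum>b\<le>2 * i. fps_nth (fps_nth h b) i)"

definition euler :: "rat fps fps \<Rightarrow> rat fps fps"
  where "euler h = fps_X * fps_deriv h"

lemma euler_power_nth: "fps_nth ((euler ^^ l) h) b = fps_const (of_nat b ^ l) * fps_nth h b"
  by (induction l) (simp_all add: euler_def fps_const_mult[symmetric] fps_of_nat mult.assoc
      del: fps_const_mult)

lemma eval_one_euler_power_nth:
  "fps_nth (eval_one ((euler ^^ l) h)) i = (\<Sum>b\<le>2 * i. of_nat b ^ l * fps_nth (fps_nth h b) i)"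
  by (simp add: eval_one_def euler_power_nth)

lemma tame_euler: "tame h \<Longrightarrow> tame (euler h)"
  using euler_power_nth[of 1 h] by (auto simp: tame_def)

lemma tame_mult:
  assumes "tame f" "tame h"
  shows "tame (f * h)"
  unfolding tame_def
proof (intro allI impI)
  fix b i :: nat assume "2 * i < b"
  have "fps_nth (fps_nth f c) s * fps_nth (fps_nth h (b - c)) (i - s) = 0" if "s \<le> i" "c \<le> b" for c s
  proof (cases "2 * s < c")
    case False
    then have "2 * (i - s) < b - c" using that \<open>2 * i < b\<close> by auto
    then show ?thesis using assms(2) by (simp add: tame_def)
  qed (use assms(1) in \<open>simp add: tame_def\<close>)
  then show "fps_nth (fps_nth (f * h) b) i = 0"
    by (simp only: fps_mult_nth fps_sum_nth) (simp add: sum.neutral)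
qed

text \<open>For tame factors the nonzero terms lie in the box \<open>c \<le> 2 * s\<close>,
  \<open>d \<le> 2 * (i - s)\<close>. This box is contained in the triangle
  \<open>c + d \<le> 2 * i\<close> at which the product is truncated.\<close>

lemma eval_one_mult:
  assumes "tame f" "tame h"
  shows "eval_one (f * h) = eval_one f * eval_one h"
proof (rule fps_ext)
  fix i
  let ?u = "\<lambda>s c. fps_nth (fps_nth f c) s" and ?v = "\<lambda>s c. fps_nth (fps_nth h c) s"
  have box: "(\<Sum>b\<le>2 * i. \<Sum>c\<le>b. ?u s c * ?v (i - s) (b - c)) =
      (\<Sum>c\<le>2 * s. ?u s c) * (\<Sum>d\<le>2 * (i - s). ?v (i - s) d)" if "s \<le> i" for s
  proof -
    have "(\<Sum>b\<le>2 * i. \<Sum>c\<le>b. ?u s c * ?v (i - s) (b - c)) =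
      (\<Sum>(c, d)\<in>{(c, d). c + d \<le> 2 * i}. ?u s c * ?v (i - s) d)"
      by (rule sum.triangle_reindex_eq[symmetric])
    also have "\<dots> = (\<Sum>(c, d)\<in>{..2 * s} \<times> {..2 * (i - s)}. ?u s c * ?v (i - s) d)"
    proof (rule sum.mono_neutral_right)
      show "finite {(c, d). c + d \<le> 2 * i}"
        by (rule finite_subset[of _ "{..2 * i} \<times> {..2 * i}"]) auto
    qed (use that in \<open>auto dest: tameD[OF assms(1)] tameD[OF assms(2)]\<close>)
    finally show ?thesis by (simp add: sum_product sum.cartesian_product)
  qed
  have "fps_nth (eval_one (f * h)) i =
      (\<Sum>b\<le>2 * i. \<Sum>c\<le>b. \<Sum>s\<le>i. ?u s c * ?v (i - s) (b - c))"
    by (simp add: eval_one_def fps_mult_nth fps_sum_nth atLeast0AtMost)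
  also have "\<dots> = (\<Sum>s\<le>i. \<Sum>b\<le>2 * i. \<Sum>c\<le>b. ?u s c * ?v (i - s) (b - c))"
    by (subst sum.swap, subst (2) sum.swap) (rule refl)
  also have "\<dots> = fps_nth (eval_one f * eval_one h) i"
    by (simp add: box fps_mult_nth eval_one_def atLeast0AtMost)
  finally show "fps_nth (eval_one (f * h)) i = fps_nth (eval_one f * eval_one h) i" .
qed

definition modular_moments :: "rat fps fps \<Rightarrow> bool"
  where "modular_moments h \<longleftrightarrow>
    tame h \<and> (\<forall>l. eval_one ((euler ^^ l) h) \<in> cusp_quasi_modular)"

lemma modular_moments_euler: "modular_moments h \<Longrightarrow> modular_moments (euler h)"
  using tame_euler unfolding modular_moments_def by (metis funpow_Suc_right o_apply)

lemma euler_power_add: "(euler ^^ l) (f + h) = (euler ^^ l) f + (euler ^^ l) h"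
  by (rule fps_ext) (simp add: euler_power_nth algebra_simps)

lemma eval_one_add: "eval_one (f + h) = eval_one f + eval_one h"
  by (simp add: eval_one_def fps_eq_iff sum.distrib)

text \<open>As \<open>euler\<close> is a derivation, moments of a product are combinations of
  products of moments. The induction generalises over both factors because each step replaces one of
  them by its derivative.\<close>

lemma modular_moments_mult:
  assumes "modular_moments f" "modular_moments h"
  shows "modular_moments (f * h)"
proof -
  have "eval_one ((euler ^^ l) (f * h)) \<in> cusp_quasi_modular" for l
    using assms
  proof (induction l arbitrary: f h)
    case 0
    then have "eval_one f \<in> cusp_quasi_modular" "eval_one h \<in> cusp_quasi_modular"
      unfolding modular_moments_def by (metis funpow_0)+
    with 0 show ?case
      by (simp add: eval_one_mult cusp_quasi_modular_mult modular_moments_def)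
  next
    case (Suc l)
    have "euler (f * h) = euler f * h + f * euler h" by (simp add: euler_def algebra_simps)
    then have "eval_one ((euler ^^ Suc l) (f * h)) =
        eval_one ((euler ^^ l) (euler f * h)) + eval_one ((euler ^^ l) (f * euler h))"
      by (simp add: funpow_Suc_right euler_power_add eval_one_add del: funpow.simps)
    then show ?case using Suc by (auto intro!: cusp_quasi_modular_add modular_moments_euler)
  qed
  then show ?thesis using assms tame_mult by (simp add: modular_moments_def)
qed

text \<open>The exponent starts at one: the constant series \<open>1\<close> has zeroth moment
  \<open>1\<close>, which does not vanish at \<open>0\<close>.\<close>

lemma modular_moments_power: "modular_moments h \<Longrightarrow> modular_moments (h ^ Suc j)"
  by (induction j) (simp_all add: modular_moments_mult)

section \<open>The polynomials \<open>x^a P_a(1/x)\<close>, their tails and the moments of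
  these\<close>

definition P_bar :: "nat \<Rightarrow> rat fps"
  where "P_bar a = (\<Sum>k | k dvd a. fps_const (of_nat (a div k)) *
    (fps_X ^ (a - k) - 2 * fps_X ^ a + fps_X ^ (a + k)))"

lemma P_bar_nth:
  "fps_nth (P_bar a) i = (\<Sum>k | k dvd a. of_nat (a div k) *
    (of_bool (i = a - k) - 2 * of_bool (i = a) + of_bool (i = a + k)))"
  by (simp add: P_bar_def fps_sum_nth fps_X_power_iff numeral_fps_const of_bool_def)

definition P_tail :: "rat fps fps"
  where "P_tail = Abs_fps (\<lambda>a. if a = 0 then 0 else P_bar a - 1)"

text \<open>A proper divisor \<open>k\<close> of \<open>a\<close> is at most \<open>a / 2\<close>,
  so its lowest exponent \<open>a - k\<close> is at least \<open>a / 2\<close>. The divisor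
  \<open>k = a\<close> contributes the subtracted \<open>1\<close> and otherwise only exponents from
  \<open>a\<close> on.\<close>

lemma tame_P_tail: "tame P_tail"
  unfolding tame_def
proof (intro allI impI)
  fix a i :: nat assume a: "2 * i < a"
  have "fps_nth (P_bar a) i = (\<Sum>k\<in>{a}. of_nat (a div k) *
    (of_bool (i = a - k) - 2 * of_bool (i = a) + of_bool (i = a + k)))"
    unfolding P_bar_nth
  proof (rule sum.mono_neutral_right)
    show "\<forall>k\<in>{k. k dvd a} - {a}. of_nat (a div k) *
      (of_bool (i = a - k) - 2 * of_bool (i = a) + of_bool (i = a + k)) = (0 :: rat)"
    proof
      fix k assume "k \<in> {k. k dvd a} - {a}"
      then obtain d where d: "a = k * d" "d \<noteq> 1" by (auto elim!: dvdE)
      with a have "d \<ge> 2" by (cases d) auto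
      then have "2 * k \<le> a" using d by (simp add: mult.commute)
      then show "of_nat (a div k) *
        (of_bool (i = a - k) - 2 * of_bool (i = a) + of_bool (i = a + k)) = (0 :: rat)"
        using a by auto
    qed
  qed (use a in auto)
  then show "fps_nth (fps_nth P_tail a) i = 0" using a by (auto simp: P_tail_def)
qed

text \<open>The constant term \<open>1\<close> of \<open>P_bar a\<close> cancels against the summand \<open>k = a\<close>; the remaining
  summands are regrouped by the exponent of \<open>x\<close>, which is \<open>a - k\<close>, \<open>a\<close> or \<open>a + k\<close>.\<close>

lemma moment_P_tail_nth:
  assumes "i > 0"
  shows "fps_nth (eval_one ((euler ^^ l) P_tail)) i =
    (\<Sum>k | k dvd i. of_nat k ^ l * ((of_nat (i div k) + 1) ^ Suc l - 2 * of_nat (i div k) ^ Suc l +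
      (of_nat (i div k) - 1) ^ Suc l))"
proof -
  define w :: "nat \<Rightarrow> nat \<Rightarrow> rat" where "w a k = of_nat a ^ l * of_nat (a div k)" for a k
  define I where "I = (SIGMA a:{1..2 * i}. {k. k dvd a})"
  have finI: "finite I" unfolding I_def by (auto simp: finite_divisors_nat)
  have fini: "finite {k. k dvd i}" using assms by (simp add: finite_divisors_nat)
  have le: "k > 0 \<and> k \<le> i" if "k dvd i" for k
    using that assms by (auto dest: dvd_imp_le dvd_pos_nat)
  have 1: "(\<Sum>(a, k)\<in>I. w a k * of_bool (i = a - k)) = (\<Sum>k | k dvd i. w (i + k) k)"
  proof -
    have "(\<Sum>(a, k)\<in>I. w a k * of_bool (i = a - k)) = (\<Sum>(a, k)\<in>{(a, k)\<in>I. i = a - k}. w a k)"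
      by (rule sum.mono_neutral_cong_right) (use finI in auto)
    also have "\<dots> = (\<Sum>k | k dvd i. w (i + k) k)"
      by (rule sum.reindex_bij_witness[where i = "\<lambda>k. (i + k, k)" and j = "\<lambda>(a, k). k"])
        (use assms le in \<open>auto simp: I_def intro!: dvd_diff_nat trans_le_add1 Suc_leI\<close>)
    finally show ?thesis .
  qed
  have 2: "(\<Sum>(a, k)\<in>I. w a k * of_bool (i = a)) = (\<Sum>k | k dvd i. w i k)"
  proof -
    have "(\<Sum>(a, k)\<in>I. w a k * of_bool (i = a)) = (\<Sum>(a, k)\<in>{(a, k)\<in>I. i = a}. w a k)"
      by (rule sum.mono_neutral_cong_right) (use finI in auto)
    also have "\<dots> = (\<Sum>k | k dvd i. w i k)"
      by (rule sum.reindex_bij_witness[where i = "\<lambda>k. (i, k)" and j = "\<lambda>(a, k). k"])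
        (use assms in \<open>auto simp: I_def\<close>)
    finally show ?thesis .
  qed
  have 3: "(\<Sum>(a, k)\<in>I. w a k * of_bool (i = a + k)) = (\<Sum>k | k dvd i. w (i - k) k)"
  proof -
    have "(\<Sum>(a, k)\<in>I. w a k * of_bool (i = a + k)) = (\<Sum>(a, k)\<in>{(a, k)\<in>I. i = a + k}. w a k)"
      by (rule sum.mono_neutral_cong_right) (use finI in auto)
    also have "\<dots> = (\<Sum>k | k dvd i \<and> k < i. w (i - k) k)"
    proof (rule sum.reindex_bij_witness[where i = "\<lambda>k. (i - k, k)" and j = "\<lambda>(a, k). k"],
        goal_cases)
      case (4 k)
      then have "k dvd i - k" "k < i" by (auto intro: dvd_diff_nat)
      then show ?case by (auto simp: I_def)
    qed (auto simp: I_def)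
    \<comment> \<open>The divisor \<open>k = i\<close> may be included because
      \<open>w 0 k = 0\<close>: even for \<open>l = 0\<close> the factor \<open>0 div k\<close>
      vanishes.\<close>
    also have "\<dots> = (\<Sum>k | k dvd i. w (i - k) k)"
      by (rule sum.mono_neutral_left) (use fini in \<open>auto simp: w_def not_less dest: le\<close>)
    finally show ?thesis .
  qed
  have "fps_nth (eval_one ((euler ^^ l) P_tail)) i =
      (\<Sum>a\<in>{1..2 * i}. of_nat a ^ l * fps_nth (P_bar a) i)"
    unfolding eval_one_euler_power_nth
    by (rule sum.mono_neutral_cong_right) (use assms in \<open>auto simp: P_tail_def\<close>)
  also have "\<dots> = (\<Sum>(a, k)\<in>I. w a k * (of_bool (i = a - k) - 2 * of_bool (i = a) + of_bool (i = a + k)))"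
    unfolding I_def P_bar_nth sum_distrib_left
    by (subst sum.Sigma) (auto simp: finite_divisors_nat w_def mult.assoc)
  also have "\<dots> = (\<Sum>(a, k)\<in>I. w a k * of_bool (i = a - k)) - 2 * (\<Sum>(a, k)\<in>I. w a k * of_bool (i = a)) +
      (\<Sum>(a, k)\<in>I. w a k * of_bool (i = a + k))"
    by (simp add: case_prod_unfold algebra_simps sum.distrib sum_subtractf sum_distrib_left)
  also have "\<dots> = (\<Sum>k | k dvd i. w (i + k) k - 2 * w i k + w (i - k) k)"
    unfolding 1 2 3 by (simp add: sum.distrib sum_subtractf sum_distrib_left)
  also have "\<dots> = (\<Sum>k | k dvd i. of_nat k ^ l * ((of_nat (i div k) + 1) ^ Suc l -
      2 * of_nat (i div k) ^ Suc l + (of_nat (i div k) - 1) ^ Suc l))"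
  proof (intro sum.cong refl)
    fix k assume "k \<in> {k. k dvd i}"
    then obtain e where e: "i = k * e" by (auto elim!: dvdE)
    with assms have "k > 0" "e > 0" by auto
    then obtain d where d: "e = Suc d" using gr0_implies_Suc by blast
    have w: "w (k * c) k = of_nat k ^ l * of_nat c ^ Suc l" for c
      using \<open>k > 0\<close> by (simp add: w_def power_mult_distrib)
    have "i + k = k * (e + 1)" "i - k = k * d" by (auto simp: e d)
    then show "w (i + k) k - 2 * w i k + w (i - k) k = of_nat k ^ l * ((of_nat (i div k) + 1) ^ Suc l -
      2 * of_nat (i div k) ^ Suc l + (of_nat (i div k) - 1) ^ Suc l)"
      using \<open>k > 0\<close> by (simp only: w e) (simp add: d right_diff_distrib distrib_left add.commute del: power_Suc)
  qed
  finally show ?thesis .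
qed

lemma theta_power_nth: "fps_nth ((theta ^^ c) f) i = of_nat i ^ c * fps_nth f i"
  by (induction c) (auto simp: theta_def)

lemma second_difference_power:
  fixes x :: "'a :: comm_ring_1"
  shows "(x + 1) ^ L - 2 * x ^ L + (x - 1) ^ L =
    (\<Sum>s = 1..L. of_nat (L choose s) * (1 + (- 1) ^ s) * x ^ (L - s))"
proof -
  have expand: "(x + z) ^ L = x ^ L + (\<Sum>s = 1..L. of_nat (L choose s) * z ^ s * x ^ (L - s))" for z
    using binomial_ring[of z x L]
    by (simp add: add.commute atMost_atLeast0 sum.atLeast_Suc_atMost)
  show ?thesis
    unfolding diff_conv_add_uminus[of x 1] expand
    by (simp add: sum.distrib algebra_simps)
qed

text \<open>With \<open>i = k * e\<close>, the product \<open>k^l * e^(l+1-s)\<close> equals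
  \<open>i^(l+1-s) * k^(s-1)\<close>: a power of \<open>theta\<close> applied to a divisor sum. The
  second difference keeps only even \<open>s\<close>, so only odd indices \<open>s - 1\<close>
  survive.\<close>

lemma moment_P_tail:
  "eval_one ((euler ^^ l) P_tail) =
    (\<Sum>s = 1..Suc l. fps_const (of_nat (Suc l choose s) * (1 + (- 1) ^ s)) *
      (theta ^^ (Suc l - s)) (sigma_fps (s - 1)))"
proof (rule fps_ext)
  fix i
  show "fps_nth (eval_one ((euler ^^ l) P_tail)) i =
    fps_nth (\<Sum>s = 1..Suc l. fps_const (of_nat (Suc l choose s) * (1 + (- 1) ^ s)) *
      (theta ^^ (Suc l - s)) (sigma_fps (s - 1))) i"
  proof (cases "i = 0")
    case True
    then show ?thesis
      by (simp add: eval_one_euler_power_nth P_tail_def fps_sum_nth theta_power_nth sigma_fps_def)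
  next
    case False
    have "of_nat k ^ l * of_nat (i div k) ^ (Suc l - s) =
        (of_nat i :: rat) ^ (Suc l - s) * of_nat k ^ (s - 1)" if "k dvd i" "s \<in> {1..Suc l}" for k s
    proof -
      from that obtain e where e: "i = k * e" by (auto elim!: dvdE)
      then have "k > 0" using False by auto
      moreover have "l = (Suc l - s) + (s - 1)" using that by auto
      then have "(of_nat k :: rat) ^ l = of_nat k ^ (Suc l - s) * of_nat k ^ (s - 1)"
        by (metis power_add)
      ultimately show ?thesis by (simp add: e power_mult_distrib)
    qed
    then have "fps_nth (eval_one ((euler ^^ l) P_tail)) i = (\<Sum>k | k dvd i. \<Sum>s = 1..Suc l.
        of_nat (Suc l choose s) * (1 + (- 1) ^ s) * (of_nat i ^ (Suc l - s) * of_nat k ^ (s - 1)))"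
      using False unfolding moment_P_tail_nth[OF False[unfolded neq0_conv]] second_difference_power sum_distrib_left
      by (intro sum.cong refl) (simp add: mult_ac del: power_Suc)
    also have "\<dots> = fps_nth (\<Sum>s = 1..Suc l. fps_const (of_nat (Suc l choose s) * (1 + (- 1) ^ s)) *
      (theta ^^ (Suc l - s)) (sigma_fps (s - 1))) i"
      using False
      by (subst sum.swap) (simp add: fps_sum_nth theta_power_nth sigma_fps_def divisor_sigma_def
          sum_distrib_left mult_ac del: binomial_Suc_Suc)
    finally show ?thesis .
  qed
qed

lemma modular_moments_P_tail: "modular_moments P_tail"
  unfolding modular_moments_def
proof (intro conjI allI tame_P_tail)
  fix l
  show "eval_one ((euler ^^ l) P_tail) \<in> cusp_quasi_modular"
    unfolding moment_P_tail
  proof (rule cusp_quasi_modular_sum)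
    fix s assume s: "s \<in> {1..Suc l}"
    show "fps_const (of_nat (Suc l choose s) * (1 + (- 1) ^ s)) *
      (theta ^^ (Suc l - s)) (sigma_fps (s - 1)) \<in> cusp_quasi_modular"
    proof (cases "even s")
      case True
      then have "odd (s - 1)" using s by auto
      then show ?thesis by (intro cusp_quasi_modular_scale theta_power_sigma_fps)
    qed (simp add: cusp_quasi_modular_0)
  qed
qed

text \<open>The zeroth moment is built from second differences of a linear function.\<close>

lemma eval_one_P_tail: "eval_one P_tail = 0"
  using moment_P_tail[of 0] by simp

section \<open>Asymptotic polynomials\<close>

definition geo :: "rat fps fps"
  where "geo = Abs_fps (\<lambda>n. if n = 0 then 0 else 1)"

text \<open>The induction step is the hockey-stick identity.\<close>

lemma geo_power_nth:
  "fps_nth (geo ^ Suc r) n = (if n = 0 then 0 else of_nat ((n - 1) choose r))"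
proof (induction r arbitrary: n)
  case 0
  show ?case by (simp add: geo_def)
next
  case (Suc r)
  show ?case
  proof (cases n)
    case (Suc n')
    have "fps_nth (geo ^ Suc (Suc r)) n =
        (\<Sum>i\<le>n. fps_nth (geo ^ Suc r) i * fps_nth geo (n - i))"
      by (subst power_Suc2) (simp only: fps_mult_nth atLeast0AtMost)
    also have "\<dots> = (\<Sum>i\<in>Suc ` {..<n'}. of_nat ((i - 1) choose r))"
    proof (rule sum.mono_neutral_cong_right)
      show "\<forall>i\<in>{..n} - Suc ` {..<n'}. fps_nth (geo ^ Suc r) i * fps_nth geo (n - i) = 0"
      proof
        fix i assume i: "i \<in> {..n} - Suc ` {..<n'}"
        show "fps_nth (geo ^ Suc r) i * fps_nth geo (n - i) = 0"
        proof (cases i)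
          case 0
          then show ?thesis by (simp only: Suc.IH) simp
        next
          case (Suc j)
          then have "n - i = 0" using i \<open>n = Suc n'\<close> by auto
          then show ?thesis by (simp add: geo_def)
        qed
      qed
      fix i assume "i \<in> Suc ` {..<n'}"
      then have "i > 0" "n - i > 0" using \<open>n = Suc n'\<close> by auto
      then show "fps_nth (geo ^ Suc r) i * fps_nth geo (n - i) = of_nat ((i - 1) choose r)"
        by (simp only: Suc.IH) (simp add: geo_def)
    qed (use \<open>n = Suc n'\<close> in auto)
    also have "\<dots> = of_nat (\<Sum>i<n'. i choose r)" by (subst sum.reindex) auto
    also have "(\<Sum>i<n'. i choose r) = n' choose Suc r"
      by (cases n') (simp_all add: sum_choose_upper lessThan_Suc_atMost del: binomial_Suc_Suc)
    finally show ?thesis using \<open>n = Suc n'\<close> by simp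
  qed (simp add: geo_def)
qed

text \<open>The binomial coefficient \<open>binom(n - 1, r)\<close> as a polynomial in
  \<open>n\<close>.\<close>

definition binomial_pred_poly :: "nat \<Rightarrow> rat poly"
  where "binomial_pred_poly r = smult (1 / fact r) (\<Prod>i<r. [:- of_nat (Suc i), 1:])"

lemma poly_binomial_pred_poly:
  "poly (binomial_pred_poly r) (of_nat (Suc n)) = of_nat (n choose r)"
  unfolding binomial_gbinomial gbinomial_prod_rev binomial_pred_poly_def
  by (simp add: poly_prod atLeast0LessThan)

lemma degree_binomial_pred_poly: "degree (binomial_pred_poly r) \<le> r"
  unfolding binomial_pred_poly_def
  by (intro order.trans[OF degree_smult_le] order.trans[OF degree_prod_sum_le]) auto

text \<open>The indices run over a full square, where the added coefficients vanish, so that the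
  sums can later be exchanged freely.\<close>

lemma poly_add_expand:
  fixes x y :: "'a :: comm_ring_1"
  assumes "degree p \<le> d"
  shows "poly p (x + y) =
    (\<Sum>k\<le>d. \<Sum>l\<le>d. coeff p (k + l) * of_nat ((k + l) choose k) * x ^ k * y ^ l)"
proof -
  let ?g = "\<lambda>k l. coeff p (k + l) * of_nat ((k + l) choose k) * x ^ k * y ^ l"
  have "poly p (x + y) = (\<Sum>s\<le>d. coeff p s * (x + y) ^ s)"
    by (subst poly_as_sum_of_monoms'[OF assms, symmetric]) (simp add: poly_sum poly_monom)
  also have "\<dots> = (\<Sum>s\<le>d. \<Sum>k\<le>s. ?g k (s - k))"
    by (simp add: binomial_ring sum_distrib_left mult.assoc)
  also have "\<dots> = (\<Sum>(k, l)\<in>{(k, l). k + l \<le> d}. ?g k l)"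
    by (rule sum.triangle_reindex_eq[symmetric])
  also have "\<dots> = (\<Sum>(k, l)\<in>{..d} \<times> {..d}. ?g k l)"
  proof (rule sum.mono_neutral_left)
    show "\<forall>q\<in>{..d} \<times> {..d} - {(k, l). k + l \<le> d}. (case q of (k, l) \<Rightarrow> ?g k l) = 0"
    proof
      fix q assume q: "q \<in> {..d} \<times> {..d} - {(k, l). k + l \<le> d}"
      obtain k l where kl: "q = (k, l)" by fastforce
      with q have "d < k + l" by auto
      then have "coeff p (k + l) = 0" using assms by (intro coeff_eq_0) simp
      then show "(case q of (k, l) \<Rightarrow> ?g k l) = 0" by (simp add: kl)
    qed
  qed auto
  finally show ?thesis by (simp add: sum.cartesian_product)
qed

text \<open>The coefficient of \<open>n^k\<close> in the sum of
  \<open>h_b * binom(n - b - 1, r)\<close> over \<open>b\<close>, where the sums of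
  \<open>b^l * h_b\<close> are written as moments.\<close>

definition asymptotic_coeff :: "rat fps fps \<Rightarrow> nat \<Rightarrow> nat \<Rightarrow> rat fps"
  where "asymptotic_coeff h r k = (\<Sum>l\<le>r. fps_const (coeff (binomial_pred_poly r) (k + l) *
    of_nat ((k + l) choose k) * (- 1) ^ l) * eval_one ((euler ^^ l) h))"

definition asymptotic_poly :: "rat fps fps \<Rightarrow> nat \<Rightarrow> rat fps poly"
  where "asymptotic_poly h r = (\<Sum>k\<le>r. monom (asymptotic_coeff h r k) k)"

text \<open>The degree bound leaves only \<open>l = 0\<close>, so the top coefficient vanishes
  together with the zeroth moment.\<close>

lemma asymptotic_coeff_top:
  "asymptotic_coeff h r r = fps_const (coeff (binomial_pred_poly r) r) * eval_one h"
proof -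
  have "asymptotic_coeff h r r = (\<Sum>l\<in>{0}. fps_const (coeff (binomial_pred_poly r) (r + l) *
    of_nat ((r + l) choose r) * (- 1) ^ l) * eval_one ((euler ^^ l) h))"
    unfolding asymptotic_coeff_def
    by (rule sum.mono_neutral_right)
      (use degree_binomial_pred_poly[of r] in \<open>auto simp: coeff_eq_0\<close>)
  then show ?thesis by simp
qed

lemma coeff_asymptotic_poly:
  "coeff (asymptotic_poly h r) k = (if k \<le> r then asymptotic_coeff h r k else 0)"
  by (simp add: asymptotic_poly_def coeff_sum)

lemma asymptotic_coeff_cusp:
  "modular_moments h \<Longrightarrow> asymptotic_coeff h r k \<in> cusp_quasi_modular"
  unfolding asymptotic_coeff_def modular_moments_def
  by (intro cusp_quasi_modular_sum cusp_quasi_modular_scale) auto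

lemma fps_of_nat_power_mult_nth:
  "fps_nth (f * of_nat n ^ k) i = of_nat n ^ k * fps_nth (f :: rat fps) i"
proof -
  have "of_nat n ^ k = fps_const (of_nat n ^ k :: rat)"
    by (simp flip: fps_const_power add: fps_of_nat)
  then show ?thesis by simp
qed

text \<open>Away from the finitely many \<open>b \<le> 2i\<close> in the support, \<open>h * geo^(r+1)\<close> has the coefficients
  \<open>\<Sum>b. h_b * binom(n - b - 1, r)\<close>, and expanding the binomial in powers of \<open>n\<close> and \<open>b\<close> produces the
  moments of \<open>h\<close>.\<close>

lemma tame_times_geo_power:
  assumes h: "tame h" and n: "2 * i < n"
  shows "fps_nth (fps_nth (h * geo ^ Suc r) n) i = fps_nth (poly (asymptotic_poly h r) (of_nat n)) i"
proof -
  let ?B = "binomial_pred_poly r"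
  let ?c = "\<lambda>k l. coeff ?B (k + l) * of_nat ((k + l) choose k) :: rat"
  have "fps_nth (fps_nth (h * geo ^ Suc r) n) i =
      (\<Sum>b\<le>n. fps_nth (fps_nth h b * fps_nth (geo ^ Suc r) (n - b)) i)"
    by (simp only: fps_mult_nth[of h] fps_sum_nth atLeast0AtMost)
  also have "\<dots> = (\<Sum>b\<le>2 * i. fps_nth (fps_nth h b) i * poly ?B (of_nat n + - of_nat b))"
  proof (rule sum.mono_neutral_cong_right)
    show "\<forall>b\<in>{..n} - {..2 * i}. fps_nth (fps_nth h b * fps_nth (geo ^ Suc r) (n - b)) i = 0"
    proof
      fix b assume "b \<in> {..n} - {..2 * i}"
      then have "fps_nth (fps_nth h b) i = 0" using h by (auto simp: tame_def)
      then show "fps_nth (fps_nth h b * fps_nth (geo ^ Suc r) (n - b)) i = 0"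
        by (simp add: geo_power_nth del: power_Suc flip: fps_of_nat)
    qed
    fix b assume "b \<in> {..2 * i}"
    \<comment> \<open>Positivity of \<open>n - b\<close> matters: at \<open>0\<close> the
      coefficient of \<open>geo ^ Suc r\<close> is \<open>0\<close>, whereas
      \<open>binomial_pred_poly r\<close> takes the value \<open>(- 1) ^ r\<close>.\<close>
    then have "n - b = Suc (n - b - 1)" "b \<le> n" using n by auto
    then have "of_nat n + - of_nat b = (of_nat (Suc (n - b - 1)) :: rat)"
      by (simp add: of_nat_diff)
    then have "poly ?B (of_nat n + - of_nat b) = of_nat ((n - b - 1) choose r)"
      by (simp only: poly_binomial_pred_poly)
    then show "fps_nth (fps_nth h b * fps_nth (geo ^ Suc r) (n - b)) i =
        fps_nth (fps_nth h b) i * poly ?B (of_nat n + - of_nat b)"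
      using \<open>b \<in> {..2 * i}\<close> n
      by (simp only:) (simp add: geo_power_nth del: power_Suc flip: fps_of_nat)
  qed (use n in auto)
  also have "\<dots> = (\<Sum>b\<le>2 * i. \<Sum>k\<le>r. \<Sum>l\<le>r. ?c k l * (- 1) ^ l * of_nat n ^ k *
      (of_nat b ^ l * fps_nth (fps_nth h b) i))"
    by (subst poly_add_expand[OF degree_binomial_pred_poly])
      (simp add: sum_distrib_left power_minus[of "of_nat b :: rat" for b] mult_ac)
  also have "\<dots> = (\<Sum>k\<le>r. \<Sum>l\<le>r. \<Sum>b\<le>2 * i. ?c k l * (- 1) ^ l * of_nat n ^ k *
      (of_nat b ^ l * fps_nth (fps_nth h b) i))"
    by (subst sum.swap, subst (2) sum.swap) (rule refl)
  also have "\<dots> = fps_nth (poly (asymptotic_poly h r) (of_nat n)) i"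
    unfolding asymptotic_poly_def asymptotic_coeff_def poly_sum poly_monom fps_sum_nth
      fps_of_nat_power_mult_nth fps_mult_left_const_nth eval_one_euler_power_nth sum_distrib_left
    by (simp add: mult_ac)
  finally show ?thesis .
qed

section \<open>Powers of the generating series of the \<open>P_bar a\<close>\<close>

definition P_series :: "rat fps fps"
  where "P_series = Abs_fps (\<lambda>a. if a = 0 then 0 else P_bar a)"

lemma P_series_eq: "P_series = P_tail + geo"
  by (rule fps_ext) (simp add: P_series_def P_tail_def geo_def)

definition correction_poly :: "nat \<Rightarrow> rat fps poly"
  where "correction_poly m = (\<Sum>j\<in>{1..<m}. smult (fps_const (of_nat (m choose j)))
    (asymptotic_poly (P_tail ^ j) (m - j - 1)))"

text \<open>In the binomial expansion of \<open>(P_tail + geo) ^ m\<close>, the term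
  \<open>j = 0\<close> gives the binomial coefficient. The term \<open>j = m\<close> is tame and so
  vanishes beyond \<open>t^(2i)\<close>; the terms between are covered by
  \<open>tame_times_geo_power\<close>.\<close>

lemma P_series_power_nth:
  assumes m: "m > 0" and n: "2 * i < n"
  shows "fps_nth (fps_nth (P_series ^ m) n) i =
    fps_nth (of_nat ((n - 1) choose (m - 1)) + poly (correction_poly m) (of_nat n)) i"
proof -
  let ?t = "\<lambda>j. fps_nth (fps_nth (of_nat (m choose j) * P_tail ^ j * geo ^ (m - j)) n) i"
  have of_nat_mult: "fps_nth (fps_nth (of_nat c * f) n) i = of_nat c * fps_nth (fps_nth f n) i"
    for c and f :: "rat fps fps"
    by (simp flip: fps_of_nat)
  have "{..m} = insert 0 (insert m {1..<m})" using m by auto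
  then have "fps_nth (fps_nth (P_series ^ m) n) i = ?t 0 + ?t m + (\<Sum>j\<in>{1..<m}. ?t j)"
    using m unfolding P_series_eq binomial_ring fps_sum_nth by simp
  also have "?t 0 = fps_nth (of_nat ((n - 1) choose (m - 1))) i"
    using geo_power_nth[of "m - 1" n] m n by simp
  also have "?t m = 0"
  proof -
    have "tame (P_tail ^ Suc (m - 1))"
      using modular_moments_power[OF modular_moments_P_tail] by (simp add: modular_moments_def)
    then have "fps_nth (fps_nth (P_tail ^ m) n) i = 0" using m n by (simp add: tame_def)
    then show ?thesis by simp
  qed
  also have "(\<Sum>j\<in>{1..<m}. ?t j) = fps_nth (poly (correction_poly m) (of_nat n)) i"
    unfolding correction_poly_def poly_sum fps_sum_nth poly_smult
  proof (rule sum.cong)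
    fix j assume j: "j \<in> {1..<m}"
    have "tame (P_tail ^ Suc (j - 1))"
      using modular_moments_power[OF modular_moments_P_tail] by (simp add: modular_moments_def)
    moreover have "Suc (j - 1) = j" "Suc (m - j - 1) = m - j" using j by auto
    ultimately show "?t j = fps_nth (fps_const (of_nat (m choose j)) *
        poly (asymptotic_poly (P_tail ^ j) (m - j - 1)) (of_nat n)) i"
      using tame_times_geo_power[of "P_tail ^ j" i n "m - j - 1"] n
      by (simp add: of_nat_mult mult.assoc)
  qed simp
  finally show ?thesis by simp
qed

text \<open>The summand \<open>j = 1\<close> has degree \<open>m - 2\<close>, but its leading coefficient is a multiple of the
  zeroth moment of \<open>P_tail\<close>, which vanishes.\<close>

lemma coeff_correction_poly:
  "coeff (correction_poly m) k \<in> cusp_quasi_modular"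
  "m \<le> k + 2 \<Longrightarrow> coeff (correction_poly m) k = 0"
proof -
  have eq: "coeff (correction_poly m) k = (\<Sum>j\<in>{1..<m}. fps_const (of_nat (m choose j)) *
      (if k \<le> m - j - 1 then asymptotic_coeff (P_tail ^ j) (m - j - 1) k else 0))"
    by (simp only: correction_poly_def coeff_sum coeff_smult coeff_asymptotic_poly)
  have "modular_moments (P_tail ^ j)" if "j \<ge> 1" for j
    using that modular_moments_power[OF modular_moments_P_tail, of "j - 1"] by simp
  then show "coeff (correction_poly m) k \<in> cusp_quasi_modular"
    unfolding eq by (intro cusp_quasi_modular_sum cusp_quasi_modular_scale)
      (auto simp: asymptotic_coeff_cusp cusp_quasi_modular_0)
  assume "m \<le> k + 2"
  have "(if k \<le> m - j - 1 then asymptotic_coeff (P_tail ^ j) (m - j - 1) k else 0) = 0"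
    if "j \<in> {1..<m}" for j
  proof (cases "k \<le> m - j - 1")
    case True
    then have "j = 1" "k = m - j - 1" using that \<open>m \<le> k + 2\<close> by auto
    then show ?thesis using asymptotic_coeff_top[of P_tail k] by (simp add: eval_one_P_tail)
  qed simp
  then show "coeff (correction_poly m) k = 0" unfolding eq by (simp add: sum.neutral)
qed

section \<open>Expansion at the top exponent\<close>

lemma fps_X_power_dvd_iff:
  "fps_X ^ n dvd f \<longleftrightarrow> (\<forall>j<n. fps_nth f j = 0)" for f :: "'a :: comm_ring_1 fps"
proof
  assume "\<forall>j<n. fps_nth f j = 0"
  then have "f = fps_X ^ n * fps_shift n f"
    by (auto simp: fps_eq_iff fps_X_power_mult_nth)
  then show "fps_X ^ n dvd f" by (rule dvdI)
qed (auto simp: fps_X_power_mult_nth elim!: dvdE)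

text \<open>\<open>top_expansion n f\<close> is \<open>x^n f(1/x)\<close> for a Laurent polynomial \<open>f\<close> of degree at most \<open>n\<close>.\<close>

definition top_expansion :: "int \<Rightarrow> (int \<Rightarrow>\<^sub>0 int) \<Rightarrow> rat fps"
  where "top_expansion n f = Abs_fps (\<lambda>i. of_int (Poly_Mapping.lookup f (n - int i)))"

lemma top_expansion_add: "top_expansion n (f + h) = top_expansion n f + top_expansion n h"
  and top_expansion_diff: "top_expansion n (f - h) = top_expansion n f - top_expansion n h"
  by (simp_all add: top_expansion_def fps_eq_iff lookup_add lookup_minus)

lemma top_expansion_sum: "top_expansion n (sum f I) = (\<Sum>i\<in>I. top_expansion n (f i))"
  by (simp add: top_expansion_def fps_eq_iff lookup_sum fps_sum_nth)

lemma top_expansion_of_nat_mult: "top_expansion n (of_nat c * f) = fps_const (of_nat c) * top_expansion n f"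
  by (induction c) (simp_all add: distrib_right top_expansion_add fps_const_add[symmetric]
      del: fps_const_add, simp add: top_expansion_def fps_eq_iff)

lemma top_expansion_single:
  "e \<le> n \<Longrightarrow> top_expansion n (Poly_Mapping.single e c) = fps_const (of_int c) * fps_X ^ nat (n - e)"
  by (auto simp: top_expansion_def fps_eq_iff lookup_single when_def fps_X_power_iff)

lemma poly_mapping_eq_sum_single:
  "f = (\<Sum>e\<in>Poly_Mapping.keys f. Poly_Mapping.single e (Poly_Mapping.lookup f e))"
proof (rule poly_mapping_eqI)
  fix e
  show "Poly_Mapping.lookup f e =
    Poly_Mapping.lookup (\<Sum>e\<in>Poly_Mapping.keys f. Poly_Mapping.single e (Poly_Mapping.lookup f e)) e"
    by (cases "e \<in> Poly_Mapping.keys f")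
      (auto simp: lookup_sum lookup_single when_def in_keys_iff)
qed

text \<open>By bilinearity this reduces to monomials. The bounds ensure that no exponent is cut off
  by \<open>top_expansion\<close>.\<close>

lemma top_expansion_mult:
  assumes f: "exps_le m f" and h: "exps_le n h"
  shows "top_expansion (m + n) (f * h) = top_expansion m f * top_expansion n h"
proof -
  let ?f = "\<lambda>e. Poly_Mapping.single e (Poly_Mapping.lookup f e)"
    and ?h = "\<lambda>e. Poly_Mapping.single e (Poly_Mapping.lookup h e)"
  have single: "top_expansion (m + n) (?f d * ?h e) = top_expansion m (?f d) * top_expansion n (?h e)"
    if "d \<in> Poly_Mapping.keys f" "e \<in> Poly_Mapping.keys h" for d e
  proof -
    have le: "d \<le> m" "e \<le> n" using that f h by (auto simp: exps_le_def)
    then have "nat (m + n - (d + e)) = nat (m - d) + nat (n - e)" by simp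
    then show ?thesis
      using le by (simp add: mult_single top_expansion_single add_mono power_add mult_ac
          flip: fps_const_mult)
  qed
  have "top_expansion (m + n) (f * h) =
      (\<Sum>d\<in>Poly_Mapping.keys f. \<Sum>e\<in>Poly_Mapping.keys h. top_expansion (m + n) (?f d * ?h e))"
    by (subst poly_mapping_eq_sum_single[of f], subst poly_mapping_eq_sum_single[of h])
      (simp add: sum_product top_expansion_sum)
  also have "\<dots> = (\<Sum>d\<in>Poly_Mapping.keys f. top_expansion m (?f d)) *
      (\<Sum>e\<in>Poly_Mapping.keys h. top_expansion n (?h e))"
    by (simp add: single sum_product)
  also have "\<dots> = top_expansion m f * top_expansion n h"
    by (simp flip: top_expansion_sum poly_mapping_eq_sum_single)
  finally show ?thesis .
qed

lemma top_expansion_P: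
  assumes "a > 0"
  shows "top_expansion (int a) (P a) = P_bar a"
  unfolding P_def P_bar_def top_expansion_sum
proof (intro sum.cong refl)
  fix k assume "k \<in> {k. k dvd a}"
  then have k: "k \<le> a" using assms by (auto dest: dvd_imp_le)
  then have nat: "nat (int a - int k) = a - k" "nat (int a + int k) = a + k" by auto
  have two: "(2 :: int \<Rightarrow>\<^sub>0 int) = Poly_Mapping.single 0 2" by simp
  show "top_expansion (int a) (of_nat (a div k) *
      (Poly_Mapping.single (int k) 1 - 2 + Poly_Mapping.single (- int k) 1)) =
    fps_const (of_nat (a div k)) * (fps_X ^ (a - k) - 2 * fps_X ^ a + fps_X ^ (a + k))"
    using k unfolding two
    by (simp only: top_expansion_of_nat_mult top_expansion_add top_expansion_diff)
      (simp add: top_expansion_single nat numeral_fps_const del: single_numeral)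
qed

lemma top_expansion_prod_P:
  "(\<forall>a\<in>set as. a \<ge> 1) \<Longrightarrow>
    top_expansion (int (sum_list as)) (prod_list (map P as)) = prod_list (map P_bar as)"
proof (induction as)
  case Nil
  show ?case using top_expansion_single[of 0 0 1] by simp
next
  case (Cons a as)
  then show ?case
    using top_expansion_mult[OF exps_le_P[of a] exps_le_prod_P[of as]] by (simp add: top_expansion_P)
qed

text \<open>A tuple with a zero part contributes nothing, as \<open>f\<close> has no constant
  term.\<close>

lemma fps_power_nth_compositions:
  fixes f :: "'a :: comm_ring_1 fps"
  assumes "m > 0" and "fps_nth f 0 = 0"
  shows "fps_nth (f ^ m) n =
    (\<Sum>as | length as = m \<and> (\<forall>a\<in>set as. a \<ge> 1) \<and> sum_list as = n. prod_list (map (fps_nth f) as))"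
proof -
  have "fps_nth (f ^ m) n = (\<Sum>as\<in>natpermute n m. prod_list (map (fps_nth f) as))"
    unfolding fps_power_nth using assms(1)
    by (auto simp: natpermute_def prod.list_conv_set_nth atLeastLessThanSuc_atLeastAtMost[symmetric]
        intro!: sum.cong prod.cong)
  also have "\<dots> = (\<Sum>as | length as = m \<and> (\<forall>a\<in>set as. a \<ge> 1) \<and> sum_list as = n.
      prod_list (map (fps_nth f) as))"
  proof (rule sum.mono_neutral_right)
    show "\<forall>as\<in>natpermute n m - {as. length as = m \<and> (\<forall>a\<in>set as. a \<ge> 1) \<and> sum_list as = n}.
      prod_list (map (fps_nth f) as) = 0"
    proof
      fix as
      assume "as \<in> natpermute n m - {as. length as = m \<and> (\<forall>a\<in>set as. a \<ge> 1) \<and> sum_list as = n}"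
      then have "0 \<in> set as" by (auto simp: natpermute_def not_le)
      then have "\<exists>bs cs. as = bs @ 0 # cs" by (rule split_list)
      then show "prod_list (map (fps_nth f) as) = 0" using assms(2) by auto
    qed
  qed (use natpermute_finite[of n m] in \<open>auto simp: natpermute_def\<close>)
  finally show ?thesis .
qed

lemma top_expansion_BG_prim:
  assumes "g \<ge> 2"
  shows "top_expansion (int n) (BG_prim g n) = fps_const (of_nat g) * fps_nth (P_series ^ (g - 1)) n"
proof -
  have "fps_nth (P_series ^ (g - 1)) n = (\<Sum>as | length as = g - 1 \<and> (\<forall>a\<in>set as. a \<ge> 1) \<and> sum_list as = n.
      prod_list (map (fps_nth P_series) as))"
    by (rule fps_power_nth_compositions) (use assms in \<open>auto simp: P_series_def\<close>)
  also have "\<dots> = (\<Sum>as | length as = g - 1 \<and> (\<forall>a\<in>set as. a \<ge> 1) \<and> sum_list as = n.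
      top_expansion (int n) (prod_list (map P as)))"
  proof (intro sum.cong refl)
    fix as assume "as \<in> {as. length as = g - 1 \<and> (\<forall>a\<in>set as. a \<ge> 1) \<and> sum_list as = n}"
    then have as: "\<forall>a\<in>set as. a \<ge> 1" "sum_list as = n" by auto
    have eq: "map (fps_nth P_series) as = map P_bar as"
      using as(1) by (auto simp: P_series_def)
    then show "prod_list (map (fps_nth P_series) as) = top_expansion (int n) (prod_list (map P as))"
      using top_expansion_prod_P[OF as(1)] unfolding eq as(2) by simp
  qed
  finally show ?thesis by (simp add: BG_prim_def top_expansion_of_nat_mult top_expansion_sum)
qed

lemma laurent_subst_1: "laurent_subst 1 f = f"
  using poly_mapping_eq_sum_single[of f] by (simp add: laurent_subst_def)

text \<open>The summand \<open>k\<close> of the multiple cover formula only involves exponents up to \<open>det B / k\<close>, so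
  only the primitive summand contributes near the top exponent \<open>det B\<close>.\<close>

lemma lookup_BG_top:
  assumes B: "B \<in> polarizations" and i: "2 * int i < det B"
  shows "Poly_Mapping.lookup (BG g B) (det B - int i) =
    Poly_Mapping.lookup (BG_prim g (nat (det B))) (det B - int i)"
proof -
  let ?K = "{k. k \<ge> 1 \<and> nat_dvd_mat k B}"
  let ?t = "\<lambda>k. of_nat (k ^ (2 * g - 1)) * laurent_subst (int k) (BG_prim g (nat (det B) div k\<^sup>2))"
  have det: "det B > 0" using B by (simp add: polarizations_def)
  have "finite ?K"
  proof (rule finite_subset)
    show "?K \<subseteq> {..nat (det B)}"
    proof
      fix k assume "k \<in> ?K"
      then have "int k dvd B $ 1 $ 1" "int k dvd B $ 1 $ 2" by (auto simp: nat_dvd_mat_def)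
      then have "int k dvd det B" unfolding det_2 by (intro dvd_diff dvd_mult2)
      then have "int k \<le> det B" using det by (rule zdvd_imp_le)
      then show "k \<in> {..nat (det B)}" by simp
    qed
  qed simp
  moreover have "1 \<in> ?K" by (simp add: nat_dvd_mat_def)
  moreover have "Poly_Mapping.lookup (?t k) (det B - int i) = 0" if k: "k \<in> ?K - {1}" for k
  proof -
    let ?n = "nat (det B) div k\<^sup>2"
    \<comment> \<open>Since \<open>k \<ge> 2\<close>, the exponents in the \<open>k\<close>-th
      summand are at most \<open>det B / 2\<close>, which is less than
      \<open>det B - i\<close>.\<close>
    have "2 * (k * ?n) \<le> k * (k * ?n)" using k by (intro mult_le_mono1) auto
    also have "\<dots> = k\<^sup>2 * ?n" by (simp add: power2_eq_square)
    also have "\<dots> \<le> nat (det B)" by simp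
    finally have "int (2 * (k * ?n)) \<le> int (nat (det B))" by (simp only: of_nat_le_iff)
    then have n: "2 * (int k * int ?n) \<le> det B" using det by simp
    have "exps_le (det B - int i - 1) (laurent_subst (int k) (BG_prim g ?n))"
      unfolding laurent_subst_def
    proof (rule exps_le_sum)
      fix e assume "e \<in> Poly_Mapping.keys (BG_prim g ?n)"
      then have "e \<le> int ?n" using exps_le_BG_prim by (auto simp: exps_le_def)
      then have "int k * e \<le> int k * int ?n" by (intro mult_left_mono) auto
      then show "exps_le (det B - int i - 1)
          (Poly_Mapping.single (int k * e) (Poly_Mapping.lookup (BG_prim g ?n) e))"
        using n i by (auto simp: exps_le_def)
    qed
    from exps_le_mult[OF exps_le_of_nat this] have "exps_le (det B - int i - 1) (?t k)"
      by (simp only: add_0)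
    then have "det B - int i \<notin> Poly_Mapping.keys (?t k)" by (force simp: exps_le_def)
    then show ?thesis by (simp only: in_keys_iff not_not)
  qed
  ultimately have "Poly_Mapping.lookup (BG g B) (det B - int i) =
      (\<Sum>k\<in>{1}. Poly_Mapping.lookup (?t k) (det B - int i))"
    unfolding BG_def lookup_sum by (intro sum.mono_neutral_right) auto
  then show ?thesis by (simp add: laurent_subst_1)
qed

text \<open>By \<open>keys_BG_star_le\<close> the numbers \<open>det B - e\<close> are nonnegative,
  so \<open>nat\<close> does not merge different exponents.\<close>

lemma coeff_BG_star_bar:
  assumes "B \<in> polarizations"
  shows "coeff (BG_star_bar g B) i = Poly_Mapping.lookup (BG_star g B) (det B - int i)"
proof -
  have "coeff (BG_star_bar g B) i =
      (\<Sum>e\<in>Poly_Mapping.keys (BG_star g B). if e = det B - int i then Poly_Mapping.lookup (BG_star g B) e else 0)"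
    unfolding BG_star_bar_def coeff_sum
    by (intro sum.cong refl) (use keys_BG_star_le[OF assms] in \<open>force simp: nat_eq_iff2\<close>)
  then show ?thesis by (simp add: in_keys_iff)
qed

section \<open>Existence and uniqueness of the asymptotic invariant\<close>

lemma lookup_BG_star:
  "Poly_Mapping.lookup (BG_star g B) e =
    of_int (det B) / (of_nat g * (of_nat g - 1)) * of_int (Poly_Mapping.lookup (BG g B) e)"
  by (simp add: BG_star_def Poly_Mapping.map.rep_eq when_def)

text \<open>Here \<open>m = g - 1\<close>. The factor \<open>n / m\<close> is what remains of
  \<open>det B / (g * (g - 1))\<close> after cancelling the factor \<open>g\<close> of
  \<open>BG_prim\<close>; it turns \<open>binom(n - 1, m - 1)\<close> into
  \<open>binom(n, m)\<close>.\<close>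

definition AR_candidate :: "nat \<Rightarrow> rat fps poly"
  where "AR_candidate m = binomial_poly m + [:0, fps_const (1 / of_nat m):] * correction_poly m"

lemma poly_binomial_poly:
  assumes "m > 0"
  shows "poly (binomial_poly m) (of_nat n) =
    fps_const (of_nat n / of_nat m) * of_nat ((n - 1) choose (m - 1))"
proof -
  have "poly (\<Prod>i<l. [:- of_nat i, 1:]) (of_nat n) = fps_const (\<Prod>i<l. of_nat n - of_nat i :: rat)" for l
    by (induction l) (simp_all add: fps_of_nat[symmetric] algebra_simps)
  then have "poly (binomial_poly m) (of_nat n) = fps_const (of_nat (n choose m))"
    by (simp add: binomial_poly_def binomial_gbinomial gbinomial_prod_rev atLeast0LessThan)
  moreover have "of_nat (n choose m) = of_nat n / of_nat m * (of_nat ((n - 1) choose (m - 1)) :: rat)"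
    using times_binomial_minus1_eq[OF assms, of n] assms
    by (simp add: field_simps flip: of_nat_mult)
  ultimately show ?thesis by (simp flip: fps_of_nat)
qed

lemma poly_AR_candidate:
  assumes "m > 0"
  shows "poly (AR_candidate m) (of_nat n) = fps_const (of_nat n / of_nat m) *
    (of_nat ((n - 1) choose (m - 1)) + poly (correction_poly m) (of_nat n))"
proof -
  have "poly [:0, fps_const (1 / of_nat m):] (of_nat n) = fps_const (of_nat n / of_nat m :: rat)"
    by (simp flip: fps_of_nat)
  then show ?thesis
    by (simp add: AR_candidate_def poly_binomial_poly[OF assms] distrib_left)
qed

lemma is_asymptotic_invariant_AR_candidate:
  assumes "g \<ge> 2"
  shows "is_asymptotic_invariant g (AR_candidate (g - 1))"
  unfolding is_asymptotic_invariant_def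
proof (intro allI exI ballI impI)
  fix i and B :: "int ^ 2 ^ 2"
  \<comment> \<open>The threshold \<open>2 * i + 1\<close> puts every \<open>j \<le> i\<close>
    within reach of both \<open>lookup_BG_top\<close> and \<open>P_series_power_nth\<close>.\<close>
  assume B: "B \<in> polarizations" and le: "int (2 * i + 1) \<le> det B"
  define n where "n = nat (det B)"
  have det: "det B = int n" using le by (simp add: n_def)
  have "coeff (BG_star_bar g B) j = fps_nth (poly (AR_candidate (g - 1)) (of_nat n)) j" if "j < i + 1" for j
  proof -
    have j: "2 * j < n" using that le by (simp add: det)
    have "coeff (BG_star_bar g B) j = of_nat n / (of_nat g * (of_nat g - 1)) *
        of_int (Poly_Mapping.lookup (BG_prim g n) (int n - int j))"
      using lookup_BG_top[OF B, of j g] j by (simp add: coeff_BG_star_bar[OF B] lookup_BG_star det)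
    also have "of_int (Poly_Mapping.lookup (BG_prim g n) (int n - int j)) =
        fps_nth (top_expansion (int n) (BG_prim g n)) j"
      by (simp add: top_expansion_def)
    also have "\<dots> = of_nat g * fps_nth (fps_nth (P_series ^ (g - 1)) n) j"
      by (simp add: top_expansion_BG_prim[OF assms])
    also have "fps_nth (fps_nth (P_series ^ (g - 1)) n) j =
        fps_nth (of_nat ((n - 1) choose (g - 1 - 1)) + poly (correction_poly (g - 1)) (of_nat n)) j"
      by (rule P_series_power_nth) (use assms j in auto)
    also have "of_nat n / (of_nat g * (of_nat g - 1)) * (of_nat g * \<dots>) =
        fps_nth (poly (AR_candidate (g - 1)) (of_nat n)) j"
      using assms by (simp add: poly_AR_candidate of_nat_diff)
    finally show ?thesis .
  qed
  then show "fps_X ^ (i + 1) dvd fps_of_poly (BG_star_bar g B) - poly (AR_candidate (g - 1)) (of_int (det B))"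
    unfolding fps_X_power_dvd_iff by (simp add: det)
qed

lemma diagonal_polarization:
  assumes "n > 0"
  obtains B where "B \<in> polarizations" "det B = int n"
proof
  let ?B = "(\<chi> i j. if i = 1 \<and> j = 1 then int n else if i = j then 1 else 0) :: int ^ 2 ^ 2"
  show "det ?B = int n" by (simp add: det_2)
  then show "?B \<in> polarizations" using assms by (simp add: polarizations_def)
qed

text \<open>For each \<open>i\<close>, the coefficient of \<open>x^i\<close> in the difference is a
  rational polynomial in \<open>n\<close> that vanishes at all large determinants. Every positive
  integer is a determinant, so this polynomial has infinitely many roots.\<close>

lemma is_asymptotic_invariant_unique:
  assumes A: "is_asymptotic_invariant g A" and A': "is_asymptotic_invariant g A'"
  shows "A = A'"
proof -
  define D where "D = A - A'"
  have "fps_nth (coeff D k) i = 0" for k i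
  proof -
    define q where "q = (\<Sum>k\<le>degree D. monom (fps_nth (coeff D k) i) k)"
    obtain N N' where
      N: "\<And>B. B \<in> polarizations \<Longrightarrow> det B \<ge> N \<Longrightarrow>
        fps_X ^ (i + 1) dvd (fps_of_poly (BG_star_bar g B) - poly A (of_int (det B)))" and
      N': "\<And>B. B \<in> polarizations \<Longrightarrow> det B \<ge> N' \<Longrightarrow>
        fps_X ^ (i + 1) dvd (fps_of_poly (BG_star_bar g B) - poly A' (of_int (det B)))"
      using A A' unfolding is_asymptotic_invariant_def by meson
    have "poly q (of_nat n) = 0" if n: "n \<ge> nat N + nat N' + 1" for n
    proof -
      obtain B where B: "B \<in> polarizations" "det B = int n"
        using diagonal_polarization[of n] n by auto
      then have "fps_X ^ (i + 1) dvd (fps_of_poly (BG_star_bar g B) - poly A' (of_nat n)) -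
          (fps_of_poly (BG_star_bar g B) - poly A (of_nat n))"
        using N[OF B(1)] N'[OF B(1)] n by (intro dvd_diff[of _ "_ - _" "_ - _"]) (simp_all add: B(2))
      then have "fps_X ^ (i + 1) dvd poly D (of_nat n)" by (simp add: D_def)
      then have "fps_nth (poly D (of_nat n)) i = 0" unfolding fps_X_power_dvd_iff by simp
      moreover have "poly q (of_nat n) = fps_nth (poly D (of_nat n)) i"
        unfolding q_def poly_sum poly_monom poly_altdef[of D] fps_sum_nth fps_of_nat_power_mult_nth
        by (simp add: mult.commute)
      ultimately show ?thesis by simp
    qed
    then have "of_nat ` {nat N + nat N' + 1..} \<subseteq> {x. poly q x = 0}" by auto
    moreover have "infinite (of_nat ` {nat N + nat N' + 1..} :: rat set)"
      by (subst finite_image_iff) (auto simp: inj_on_def infinite_Ici)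
    ultimately have "q = 0" using poly_roots_finite[of q] finite_subset by blast
    then have "coeff q k = 0" by simp
    then show ?thesis by (cases "k \<le> degree D") (auto simp: q_def coeff_sum coeff_eq_0)
  qed
  then have "D = 0" by (intro poly_eqI fps_ext) simp
  then show ?thesis by (simp add: D_def)
qed

lemma AR_star_eq:
  assumes "g \<ge> 2"
  shows "AR_star g = AR_candidate (g - 1)"
  unfolding AR_star_def
  using is_asymptotic_invariant_AR_candidate[OF assms]
  by (rule the_equality) (rule is_asymptotic_invariant_unique[OF _ is_asymptotic_invariant_AR_candidate[OF assms]])

theorem theorem3p4:
  fixes g :: nat
  assumes "g \<ge> 2"
  shows "\<exists>f :: nat \<Rightarrow> rat fps.
    (\<forall>k\<in>{1..g - 3}. f k \<in> quasi_modular \<and> fps_nth (f k) 0 = 0) \<and>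
    AR_star g = binomial_poly (g - 1) + (\<Sum>k = 1..g - 3. monom (f k) k)"
proof -
  define m where "m = g - 1"
  \<comment> \<open>The factor \<open>n / m\<close> shifts degrees by one. The coefficient at
    \<open>k - 1\<close> vanishes once \<open>k \<ge> m - 1\<close>, so the sum ends at
    \<open>m - 2 = g - 3\<close>.\<close>
  define f where "f k = fps_const (1 / of_nat m) * coeff (correction_poly m) (k - 1)" for k
  have "f k \<in> cusp_quasi_modular" for k
    unfolding f_def by (intro cusp_quasi_modular_scale coeff_correction_poly)
  then have "\<forall>k\<in>{1..g - 3}. f k \<in> quasi_modular \<and> fps_nth (f k) 0 = 0"
    by (simp add: cusp_quasi_modular_def)
  moreover have "[:0, fps_const (1 / of_nat m):] * correction_poly m = (\<Sum>k = 1..g - 3. monom (f k) k)"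
  proof (rule poly_eqI)
    fix k
    show "coeff ([:0, fps_const (1 / of_nat m):] * correction_poly m) k =
        coeff (\<Sum>k = 1..g - 3. monom (f k) k) k"
      using coeff_correction_poly(2)[of m "k - 1"]
      by (cases k) (auto simp: coeff_sum f_def m_def)
  qed
  ultimately show ?thesis
    using AR_star_eq[OF assms] unfolding AR_candidate_def m_def by auto
qed

end
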